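(* Let $d=1$, and let $p\in(1,\infty)$ and $m>0$ satisfy $m(p-1)>1$ and $p>2$. Let $o\in\mathbb{R}$. For every $x\in\mathbb{R}\setminus\{o\}$ and every probabilistically weak solution $X$ (as defined in the context) starting at $x$, on a stochastic basis $(\Omega,\mathscr{F},\mathscr{F}_\bullet,\mathbf{P}^x)$, let $L^o$ be the local time of $X$ at $o$ and let $\mu^o$ be the random measure on $[0,\infty)$ whose primitive is the ($\mathbf{P}^x$-a.s. continuous and nondecreasing) function $t\mapsto L^o_t$, i.e. $\mu^o([0,t])=L_t^o$ for all $t\ge0$. Then $\mu^o$ is $\mathbf{P}^x$-a.s. concentrated on $\{t\in[0,\infty):X_t=o\}$.
   Context: Here $d=1$, and $p>2$ is the condition $dp>d+1$ for $d=1$. Parameters: $\beta:=p+m(p-1)-1$, $\gamma:=\frac{p-1}{m(p-1)-1}$, $\kappa:=\frac{m(p-1)-1}{mp}\beta^{-1/(p-1)}$, all positive. Barenblatt profile: for $t>0$, $r\ge 0$, $S(t,r):=C-\kappa[t^{-1/\beta}r]^{p/(p-1)}$ and $U(t,r):=t^{-1/\beta}\,\max\{S(t,r),0\}^\gamma$, where $C>0$ is the unique constant (depending only on $p,m$) such that $2\int_0^\infty U(t,r)\,\mathrm{d}r=1$ for every $t>0$. Put $\rho:=(C/\kappa)^{(p-1)/p}$; the support of $U(t,\cdot)$ is $[0,\rho t^{1/\beta}]$. The Barenblatt solution is $w^x(t,y):=U(t,|y-x|)$. Coefficients: for $0<r<\rho t^{1/\beta}$ let $a(t,r):=m^{p-1}|\partial_rU(t,r)|^{p-2}U(t,r)^{(m-1)(p-1)}$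 and $a_r:=\partial_r a$; set $a(t,r):=a_r(t,r):=0$ for $r\ge\rho t^{1/\beta}$ and for $r=0$. For $z\in\mathbb{R}$, $\mathrm{sgn}\,z:=z/|z|$ if $z\ne0$, $\mathrm{sgn}\,0:=0$. A stochastic basis is a complete probability space $(\Omega,\mathscr{F},\mathbf{P}^x)$ with a right-continuous filtration $\mathscr{F}_\bullet$ augmented by null sets; $\mathbf{E}^x$ denotes expectation. A probabilistically weak solution starting at $x\in\mathbb{R}$ is a continuous $\mathscr{F}_\bullet$-adapted real process $X$ on a stochastic basis carrying a standard $\mathscr{F}_\bullet$-Brownian motion $W$ on $\mathbb{R}$ such that (a) $\mathbf{E}^x[\int_0^t a(s,|X_s-x|)\,\mathrm{d}s]<\infty$ and $\mathbf{E}^x[\int_0^t|a_r(s,|X_s-x|)|\,\mathrm{d}s]<\infty$ for every $t>0$; (b) $\mathbf{P}^x$-a.s., for all $t\ge0$, $X_t=X_0+\int_0^t\sqrt{2a(s,|X_s-x|)}\,\mathrm{d}W_s+\int_0^t a_r(s,|X_s-x|)\,\mathrm{sgn}(X_s-x)\,\mathrm{d}s$; (c) for every $t>0$ the law of $X_t$ is $w^x(t,\cdot)\,\mathscr{L}^1$; consequently $X_0=x$ a.s. Local time: $L^o$ is the local time at $o$ of the continuous semimartingale $X$, i.e. the nonnegative, nondecreasing, adapted process given by Tanaka's formula $|X_t-o|=|x-o|+\int_0^t\mathrm{sgn}(X_s-o)\,\mathrm{d}X_s+L_t^o$, taken in the modification for which $(t,o)\mapsto L_t^o$ is jointly continuous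 outside a $\mathbf{P}^x$-null set. *)

theory Defs
  imports "HOL-Probability.Probability"
begin

section \<open>Barenblatt solution in dimension one\<close>

definition bar_beta :: "real \<Rightarrow> real \<Rightarrow> real" where
  "bar_beta p m = p + m * (p - 1) - 1"

definition bar_gamma :: "real \<Rightarrow> real \<Rightarrow> real" where
  "bar_gamma p m = (p - 1) / (m * (p - 1) - 1)"

definition bar_kappa :: "real \<Rightarrow> real \<Rightarrow> real" where
  "bar_kappa p m = (m * (p - 1) - 1) / (m * p) * bar_beta p m powr (- (1 / (p - 1)))"

definition bar_profile :: "real \<Rightarrow> real \<Rightarrow> real \<Rightarrow> real \<Rightarrow> real \<Rightarrow> real" where
  "bar_profile p m C t r =
     t powr (- (1 / bar_beta p m)) *
     max (C - bar_kappa p m * (t powr (- (1 / bar_beta p m)) * r) powr (p / (p - 1))) 0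
       powr bar_gamma p m"

definition bar_C :: "real \<Rightarrow> real \<Rightarrow> real" where
  "bar_C p m = (THE C. 0 < C \<and>
     (\<forall>t>0. 2 * (LINT r:{0..}|lborel. bar_profile p m C t r) = 1))"

definition bar_U :: "real \<Rightarrow> real \<Rightarrow> real \<Rightarrow> real \<Rightarrow> real" where
  "bar_U p m t r = bar_profile p m (bar_C p m) t r"

definition bar_rho :: "real \<Rightarrow> real \<Rightarrow> real" where
  "bar_rho p m = (bar_C p m / bar_kappa p m) powr ((p - 1) / p)"

definition bar_w :: "real \<Rightarrow> real \<Rightarrow> real \<Rightarrow> real \<Rightarrow> real \<Rightarrow> real" where
  "bar_w p m x t y = bar_U p m t \<bar>y - x\<bar>"

text \<open>At \<open>t = 0\<close> the interval \<open>0 < r < \<rho> t\<^sup>1\<^sup>/\<^sup>\<beta>\<close> is empty, so both coefficients vanish there.\<close>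

definition coeff_a :: "real \<Rightarrow> real \<Rightarrow> real \<Rightarrow> real \<Rightarrow> real" where
  "coeff_a p m t r =
     (if 0 < r \<and> r < bar_rho p m * t powr (1 / bar_beta p m)
      then m powr (p - 1) * \<bar>deriv (bar_U p m t) r\<bar> powr (p - 2)
             * bar_U p m t r powr ((m - 1) * (p - 1))
      else 0)"

definition coeff_a_r :: "real \<Rightarrow> real \<Rightarrow> real \<Rightarrow> real \<Rightarrow> real" where
  "coeff_a_r p m t r =
     (if 0 < r \<and> r < bar_rho p m * t powr (1 / bar_beta p m)
      then deriv (coeff_a p m t) r else 0)"


section \<open>Stochastic bases, Brownian motion\<close>

text \<open>The time set is \<open>[0,\<infinity>)\<close>; processes and filtrations are indexed by \<^typ>\<open>real\<close> and only
  their values at nonnegative times matter.\<close>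

locale stochastic_basis = prob_space M + complete_measure M
  for M :: "'w measure" and F :: "real \<Rightarrow> 'w measure" +
  assumes subalg: "0 \<le> t \<Longrightarrow> subalgebra M (F t)"
    and mono: "0 \<le> s \<Longrightarrow> s \<le> t \<Longrightarrow> subalgebra (F t) (F s)"
    and right_continuous: "0 \<le> t \<Longrightarrow> sets (F t) = (\<Inter>u\<in>{t<..}. sets (F u))"
    and augmented: "null_sets M \<subseteq> sets (F 0)"

definition adapted_process :: "(real \<Rightarrow> 'w measure) \<Rightarrow> (real \<Rightarrow> 'w \<Rightarrow> real) \<Rightarrow> bool" where
  "adapted_process F X \<longleftrightarrow> (\<forall>t\<ge>0. X t \<in> borel_measurable (F t))"

definition continuous_process :: "'w measure \<Rightarrow> (real \<Rightarrow> 'w \<Rightarrow> real) \<Rightarrow> bool" where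
  "continuous_process M X \<longleftrightarrow> (\<forall>\<omega>\<in>space M. continuous_on {0..} (\<lambda>t. X t \<omega>))"

definition progressive_process :: "(real \<Rightarrow> 'w measure) \<Rightarrow> (real \<Rightarrow> 'w \<Rightarrow> real) \<Rightarrow> bool" where
  "progressive_process F H \<longleftrightarrow>
     (\<forall>t\<ge>0. (\<lambda>(s, \<omega>). H s \<omega>) \<in> borel_measurable (restrict_space borel {0..t} \<Otimes>\<^sub>M F t))"

definition brownian_motion ::
  "'w measure \<Rightarrow> (real \<Rightarrow> 'w measure) \<Rightarrow> (real \<Rightarrow> 'w \<Rightarrow> real) \<Rightarrow> bool" where
  "brownian_motion M F W \<longleftrightarrow>
     adapted_process F W \<and> continuous_process M W \<and> (AE \<omega> in M. W 0 \<omega> = 0) \<and>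
     (\<forall>s t. 0 \<le> s \<and> s < t \<longrightarrow>
        distributed M lborel (\<lambda>\<omega>. W t \<omega> - W s \<omega>)
          (\<lambda>y. ennreal (normal_density 0 (sqrt (t - s)) y)) \<and>
        prob_space.indep_set M (sets (F s))
          {(\<lambda>\<omega>. W t \<omega> - W s \<omega>) -` B \<inter> space M | B. B \<in> sets borel})"


section \<open>Stochastic integral\<close>

text \<open>A simple process \<open>\<Sum>i<k. \<xi>\<^sub>i 1\<^bsub>(\<tau>\<^sub>i, \<tau>\<^sub>i\<^sub>+\<^sub>1]\<^esub>\<close> is given by \<open>k\<close>, \<open>\<tau>\<close> and \<open>\<xi>\<close>, with \<open>\<xi>\<^sub>i\<close> bounded and
  measurable at time \<open>\<tau>\<^sub>i\<close>.\<close>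

definition simple_process ::
  "'w measure \<Rightarrow> (real \<Rightarrow> 'w measure) \<Rightarrow> nat \<Rightarrow> (nat \<Rightarrow> real) \<Rightarrow> (nat \<Rightarrow> 'w \<Rightarrow> real) \<Rightarrow> bool" where
  "simple_process M F k \<tau> \<xi> \<longleftrightarrow>
     0 \<le> \<tau> 0 \<and> (\<forall>i<k. \<tau> i \<le> \<tau> (Suc i)) \<and>
     (\<forall>i<k. \<xi> i \<in> borel_measurable (F (\<tau> i)) \<and> (\<exists>B. \<forall>\<omega>\<in>space M. \<bar>\<xi> i \<omega>\<bar> \<le> B))"

definition simple_value ::
  "nat \<Rightarrow> (nat \<Rightarrow> real) \<Rightarrow> (nat \<Rightarrow> 'w \<Rightarrow> real) \<Rightarrow> real \<Rightarrow> 'w \<Rightarrow> real" where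
  "simple_value k \<tau> \<xi> s \<omega> = (\<Sum>i<k. \<xi> i \<omega> * indicator {\<tau> i<..\<tau> (Suc i)} s)"

definition simple_integral ::
  "(real \<Rightarrow> 'w \<Rightarrow> real) \<Rightarrow> nat \<Rightarrow> (nat \<Rightarrow> real) \<Rightarrow> (nat \<Rightarrow> 'w \<Rightarrow> real) \<Rightarrow> real \<Rightarrow> 'w \<Rightarrow> real" where
  "simple_integral W k \<tau> \<xi> t \<omega> =
     (\<Sum>i<k. \<xi> i \<omega> * (W (min (\<tau> (Suc i)) t) \<omega> - W (min (\<tau> i) t) \<omega>))"

text \<open>\<open>is_ito_integral M F W H I\<close>: the continuous adapted process \<open>I\<close> is (a version of)
  \<open>t \<mapsto> \<integral>\<^sub>0\<^sup>t H dW\<close> for a progressive \<open>H\<close> with \<open>\<integral>\<^sub>0\<^sup>T H\<^sup>2 ds < \<infinity>\<close> a.s. for all \<open>T\<close>. It is the limit,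
  uniformly on compacts in probability, of the elementary integrals of simple \<open>H\<^sub>n\<close> with
  \<open>\<integral>\<^sub>0\<^sup>T (H\<^sub>n - H)\<^sup>2 ds \<rightarrow> 0\<close> in probability for all \<open>T\<close>; it does not depend on the approximating
  sequence, up to indistinguishability.\<close>

definition is_ito_integral ::
  "'w measure \<Rightarrow> (real \<Rightarrow> 'w measure) \<Rightarrow> (real \<Rightarrow> 'w \<Rightarrow> real) \<Rightarrow> (real \<Rightarrow> 'w \<Rightarrow> real)
     \<Rightarrow> (real \<Rightarrow> 'w \<Rightarrow> real) \<Rightarrow> bool" where
  "is_ito_integral M F W H I \<longleftrightarrow>
     progressive_process F H \<and>
     (AE \<omega> in M. \<forall>T\<ge>0. (\<integral>\<^sup>+ s\<in>{0..T}. ennreal ((H s \<omega>)\<^sup>2) \<partial>lborel) < \<infinity>) \<and>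
     adapted_process F I \<and> continuous_process M I \<and>
     (\<exists>k \<tau> \<xi>. (\<forall>n. simple_process M F (k n) (\<tau> n) (\<xi> n)) \<and>
        (\<forall>T\<ge>0. \<forall>\<epsilon>>0.
           (\<lambda>n. measure M {\<omega>\<in>space M.
              ennreal \<epsilon> < (\<integral>\<^sup>+ s\<in>{0..T}.
                 ennreal ((simple_value (k n) (\<tau> n) (\<xi> n) s \<omega> - H s \<omega>)\<^sup>2) \<partial>lborel)})
             \<longlonglongrightarrow> 0 \<and>
           (\<lambda>n. measure M {\<omega>\<in>space M.
              \<exists>t\<in>{0..T}. \<epsilon> < \<bar>simple_integral W (k n) (\<tau> n) (\<xi> n) t \<omega> - I t \<omega>\<bar>})
             \<longlonglongrightarrow> 0))"

text \<open>For an Ito process \<open>dX = \<sigma> dW + b ds\<close>, a continuous semimartingale with martingale part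
  \<open>\<integral>\<sigma> dW\<close> and finite variation part \<open>\<integral>b ds\<close>, the process \<open>Y\<close> is the semimartingale integral
  \<open>\<integral>H dX = \<integral>H \<sigma> dW + \<integral>H b ds\<close>.\<close>

definition is_ito_process_integral ::
  "'w measure \<Rightarrow> (real \<Rightarrow> 'w measure) \<Rightarrow> (real \<Rightarrow> 'w \<Rightarrow> real) \<Rightarrow> (real \<Rightarrow> 'w \<Rightarrow> real)
     \<Rightarrow> (real \<Rightarrow> 'w \<Rightarrow> real) \<Rightarrow> (real \<Rightarrow> 'w \<Rightarrow> real) \<Rightarrow> (real \<Rightarrow> 'w \<Rightarrow> real) \<Rightarrow> bool" where
  "is_ito_process_integral M F W \<sigma> b H Y \<longleftrightarrow>
     (\<exists>I. is_ito_integral M F W (\<lambda>s \<omega>. H s \<omega> * \<sigma> s \<omega>) I \<and>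
        (AE \<omega> in M. \<forall>t\<ge>0. set_integrable lborel {0..t} (\<lambda>s. H s \<omega> * b s \<omega>) \<and>
           Y t \<omega> = I t \<omega> + (LINT s:{0..t}|lborel. H s \<omega> * b s \<omega>)))"


section \<open>Weak solutions and their local times\<close>

definition diffusion_coeff ::
  "real \<Rightarrow> real \<Rightarrow> real \<Rightarrow> (real \<Rightarrow> 'w \<Rightarrow> real) \<Rightarrow> real \<Rightarrow> 'w \<Rightarrow> real" where
  "diffusion_coeff p m x X s \<omega> = sqrt (2 * coeff_a p m s \<bar>X s \<omega> - x\<bar>)"

definition drift_coeff ::
  "real \<Rightarrow> real \<Rightarrow> real \<Rightarrow> (real \<Rightarrow> 'w \<Rightarrow> real) \<Rightarrow> real \<Rightarrow> 'w \<Rightarrow> real" where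
  "drift_coeff p m x X s \<omega> = coeff_a_r p m s \<bar>X s \<omega> - x\<bar> * sgn (X s \<omega> - x)"

text \<open>\<open>X 0 = x\<close> a.s. is not assumed: it follows from the prescribed laws and path continuity.\<close>

definition weak_solution ::
  "real \<Rightarrow> real \<Rightarrow> real \<Rightarrow> 'w measure \<Rightarrow> (real \<Rightarrow> 'w measure) \<Rightarrow> (real \<Rightarrow> 'w \<Rightarrow> real)
     \<Rightarrow> (real \<Rightarrow> 'w \<Rightarrow> real) \<Rightarrow> bool" where
  "weak_solution p m x M F W X \<longleftrightarrow>
     stochastic_basis M F \<and> brownian_motion M F W \<and>
     adapted_process F X \<and> continuous_process M X \<and>
     (\<forall>t>0. (\<integral>\<^sup>+ \<omega>. (\<integral>\<^sup>+ s\<in>{0..t}. ennreal (coeff_a p m s \<bar>X s \<omega> - x\<bar>) \<partial>lborel) \<partial>M) < \<infinity>) \<and>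
     (\<forall>t>0. (\<integral>\<^sup>+ \<omega>. (\<integral>\<^sup>+ s\<in>{0..t}. ennreal \<bar>coeff_a_r p m s \<bar>X s \<omega> - x\<bar>\<bar> \<partial>lborel) \<partial>M) < \<infinity>) \<and>
     (\<exists>I. is_ito_integral M F W (diffusion_coeff p m x X) I \<and>
        (AE \<omega> in M. \<forall>t\<ge>0. X t \<omega> =
           X 0 \<omega> + I t \<omega> + (LINT s:{0..t}|lborel. drift_coeff p m x X s \<omega>))) \<and>
     (\<forall>t>0. distributed M lborel (X t) (\<lambda>y. ennreal (bar_w p m x t y)))"

text \<open>The family \<open>L t c\<close> (time \<open>t\<close>, level \<open>c\<close>) of local times of a solution, given by Tanaka's
  formula with the symmetric sign function (\<open>sgn 0 = 0\<close>), in a jointly continuous version.\<close>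

definition local_time ::
  "real \<Rightarrow> real \<Rightarrow> real \<Rightarrow> 'w measure \<Rightarrow> (real \<Rightarrow> 'w measure) \<Rightarrow> (real \<Rightarrow> 'w \<Rightarrow> real)
     \<Rightarrow> (real \<Rightarrow> 'w \<Rightarrow> real) \<Rightarrow> (real \<Rightarrow> real \<Rightarrow> 'w \<Rightarrow> real) \<Rightarrow> bool" where
  "local_time p m x M F W X L \<longleftrightarrow>
     (\<forall>c. adapted_process F (\<lambda>t. L t c) \<and>
        (AE \<omega> in M. (\<forall>t\<ge>0. 0 \<le> L t c \<omega>) \<and> mono_on {0..} (\<lambda>t. L t c \<omega>)) \<and>
        (\<exists>Y. is_ito_process_integral M F W (diffusion_coeff p m x X) (drift_coeff p m x X)
               (\<lambda>s \<omega>. sgn (X s \<omega> - c)) Y \<and>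
             (AE \<omega> in M. \<forall>t\<ge>0. \<bar>X t \<omega> - c\<bar> = \<bar>x - c\<bar> + Y t \<omega> + L t c \<omega>))) \<and>
     (AE \<omega> in M. continuous_on ({0..} \<times> UNIV) (\<lambda>(t, c). L t c \<omega>))"


section \<open>Random measures on the half line\<close>

definition random_measure :: "'w measure \<Rightarrow> ('w \<Rightarrow> real measure) \<Rightarrow> bool" where
  "random_measure M \<mu> \<longleftrightarrow>
     (\<forall>\<omega>\<in>space M. sets (\<mu> \<omega>) = sets (restrict_space borel {0..})) \<and>
     (\<forall>B\<in>sets (restrict_space borel {0..}). (\<lambda>\<omega>. emeasure (\<mu> \<omega>) B) \<in> borel_measurable M)"

definition concentrated_on :: "'a measure \<Rightarrow> 'a set \<Rightarrow> bool" where
  "concentrated_on \<nu> A \<longleftrightarrow> space \<nu> - A \<in> null_sets \<nu>"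

end

theory Submission
  imports Defs
begin

text \<open>
  On an interval where \<open>X\<close> stays on one side of the level \<open>z\<close>, the integrands of \<open>X\<close> and of the
  stochastic integral in Tanaka's formula agree up to a constant sign, so \<open>\<bar>X - z\<bar>\<close> and that
  integral have the same increment and the local time does not grow. The event that \<open>X\<close> stays on
  one side is not measurable at the left endpoint; what makes the argument work is that the Ito
  integral is local: its increments over \<open>[q, r]\<close> almost surely depend only on the path of the
  integrand over \<open>[q, r]\<close>. The open set \<open>{t. X t \<noteq> z}\<close> is \<open>{0}\<close> together with countably many intervals
  \<open>(q, r]\<close> with rational endpoints, and \<open>\<mu>\<close> vanishes on each of them.
\<close>

section \<open>Elementary stochastic integrals\<close>

text \<open>Why locality needs an argument: \<open>is_ito_integral\<close> gives \<open>I\<close>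
  and \<open>I'\<close> as limits in probability of two unrelated sequences of simple processes, so
  agreement of \<open>H\<close> and \<open>H'\<close> along one path over \<open>[q, r]\<close>
  cannot be read off the approximations. It shows only in the energy: on such a path both simple
  processes are L2-close to the same function, hence their difference on a common grid has small
  quadratic energy. The tail bound for elementary integrals therefore refers to the energy of each
  individual path and yields one small set that serves all paths at once, whatever the event of
  agreement looks like. Isometry and Chebyshev are applied to an adapted truncation; the path
  condition enters only afterwards, to see that the truncation changed nothing on that path. The
  second obstacle is time 0, which no interval \<open>(q, r]\<close> with \<open>q \<ge> 0\<close>
  contains. An atom there is excluded by \<open>L 0 = 0\<close>, for which Tanaka's formula needs
  the start \<open>X 0 = x\<close>; this comes from the shrinking support of the Barenblatt
  profile.\<close>

lemma (in prob_space) indep_var_if_indep_set_vimage: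
  fixes X Y :: "'a \<Rightarrow> real"
  assumes ind: "indep_set (sets G) {X -` B \<inter> space M | B. B \<in> sets borel}"
    and G: "subalgebra M G" and Y: "Y \<in> borel_measurable G" and X: "X \<in> borel_measurable M"
  shows "indep_var borel Y borel X"
proof -
  have YM: "Y \<in> borel_measurable M"
    using measurable_from_subalg[OF G Y] .
  have sp: "space G = space M"
    using G by (simp add: subalgebra_def)
  have "{Y -` A \<inter> space M | A. A \<in> sets borel} \<subseteq> sets G"
    using Y by (auto simp: sp[symmetric] measurable_sets)
  then have 1: "sigma_sets (space M) {Y -` A \<inter> space M | A. A \<in> sets borel} \<subseteq> sets G"
    using sets.sigma_sets_subset[of _ G] by (simp add: sp)
  \<comment> \<open>Preimages of Borel sets under one map already form a sigma-algebra, so the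
    family in the definition of \<open>brownian_motion\<close> is the generated one that
    \<open>indep_var\<close> asks for.\<close>
  have 2: "sigma_sets (space M) {X -` A \<inter> space M | A. A \<in> sets borel}
      = {X -` A \<inter> space M | A. A \<in> sets borel}"
    using sets.sigma_sets_eq[of "vimage_algebra (space M) X borel"]
    by (simp add: sets_vimage_algebra2)
  have "indep_set (sigma_sets (space M) {Y -` A \<inter> space M | A. A \<in> sets borel})
      (sigma_sets (space M) {X -` A \<inter> space M | A. A \<in> sets borel})"
    unfolding 2 using ind unfolding indep_set_def
    by (rule indep_sets_mono_sets) (use 1 in \<open>auto split: bool.split\<close>)
  with X YM show ?thesis
    by (simp add: indep_var_eq)
qed

context stochastic_basis
begin

lemma measurable_F_M: "0 \<le> t \<Longrightarrow> f \<in> borel_measurable (F t) \<Longrightarrow> f \<in> borel_measurable M"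
  using measurable_from_subalg[OF subalg] .

lemma measurable_F_mono:
  "0 \<le> s \<Longrightarrow> s \<le> t \<Longrightarrow> f \<in> borel_measurable (F s) \<Longrightarrow> f \<in> borel_measurable (F t)"
  using measurable_from_subalg[OF mono] .

lemma adapted_measurable:
  "adapted_process F Z \<Longrightarrow> 0 \<le> t \<Longrightarrow> Z t \<in> borel_measurable M"
  by (auto simp: adapted_process_def intro: measurable_F_M)

text \<open>Independence of \<open>Y\<close> and the increment factorises both expectations, and
  integrability of the factors carries over to the products. The first pair kills the cross terms of
  the isometry, the second evaluates its diagonal.\<close>

lemma brownian_increment:
  fixes Y :: "'w \<Rightarrow> real"
  assumes W: "brownian_motion M F W" and st: "0 \<le> s" "s < t"
    and Y: "Y \<in> borel_measurable (F s)" "integrable M Y"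
  shows "integrable M (\<lambda>\<omega>. Y \<omega> * (W t \<omega> - W s \<omega>))"
    and "expectation (\<lambda>\<omega>. Y \<omega> * (W t \<omega> - W s \<omega>)) = 0"
    and "integrable M (\<lambda>\<omega>. Y \<omega> * (W t \<omega> - W s \<omega>)\<^sup>2)"
    and "expectation (\<lambda>\<omega>. Y \<omega> * (W t \<omega> - W s \<omega>)\<^sup>2) = expectation Y * (t - s)"
proof -
  let ?D = "\<lambda>\<omega>. W t \<omega> - W s \<omega>"
  let ?\<sigma> = "sqrt (t - s)"
  have \<sigma>: "0 < ?\<sigma>"
    using st by simp
  have D: "distributed M lborel ?D (\<lambda>y. ennreal (normal_density 0 ?\<sigma> y))"
    and ind: "indep_set (sets (F s)) {?D -` B \<inter> space M | B. B \<in> sets borel}"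
    using W st by (auto simp: brownian_motion_def)
  have [measurable]: "?D \<in> borel_measurable M"
    using distributed_measurable[OF D] by simp
  have iv: "indep_var borel Y borel ?D"
    using ind subalg[OF st(1)] Y(1) by (rule indep_var_if_indep_set_vimage) simp
  have "indep_var borel (id \<circ> Y) borel ((\<lambda>x::real. x\<^sup>2) \<circ> ?D)"
    using iv by (rule indep_var_compose) auto
  then have iv2: "indep_var borel Y borel (\<lambda>\<omega>. (?D \<omega>)\<^sup>2)"
    by (simp add: comp_def)
  have i1: "integrable M ?D"
    using distributed_integrable[OF D, of "\<lambda>x. x"] integrable_normal_moment_nz_1[OF \<sigma>, of 0] by simp
  have i2: "integrable M (\<lambda>\<omega>. (?D \<omega>)\<^sup>2)"
    using distributed_integrable[OF D, of "\<lambda>x. x\<^sup>2"] integrable_normal_moment[OF \<sigma>, of 0 2] by simp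
  have e1: "expectation ?D = 0"
    using distributed_integral[OF D, of "\<lambda>x. x"] integral_normal_moment_nz_1[OF \<sigma>, of 0] by simp
  have e2: "expectation (\<lambda>\<omega>. (?D \<omega>)\<^sup>2) = t - s"
    using distributed_integral[OF D, of "\<lambda>x. x\<^sup>2"] integral_normal_moment_even[OF \<sigma>, of 0 1] st
    by (simp add: power_divide)
  show "integrable M (\<lambda>\<omega>. Y \<omega> * ?D \<omega>)" "expectation (\<lambda>\<omega>. Y \<omega> * ?D \<omega>) = 0"
    using indep_var_integrable[OF iv Y(2) i1] indep_var_lebesgue_integral[OF iv Y(2) i1] e1 by simp_all
  show "integrable M (\<lambda>\<omega>. Y \<omega> * (?D \<omega>)\<^sup>2)"
    "expectation (\<lambda>\<omega>. Y \<omega> * (?D \<omega>)\<^sup>2) = expectation Y * (t - s)"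
    using indep_var_integrable[OF iv2 Y(2) i2] indep_var_lebesgue_integral[OF iv2 Y(2) i2] e2
    by simp_all
qed

text \<open>In the induction step the sum so far and \<open>g N\<close> are known at time
  \<open>t N\<close>; so the cross term has mean zero, and the new square contributes its energy.
  Integrability is part of the claim because the cross term needs the old sum in L1, which follows
  from L2.\<close>

lemma elementary_integral_isometry:
  assumes W: "brownian_motion M F W" and t: "0 \<le> t 0" "\<And>j. j < N \<Longrightarrow> t j < t (Suc j)"
    and g: "\<And>j. j < N \<Longrightarrow> g j \<in> borel_measurable (F (t j))"
    and B: "\<And>j \<omega>. j < N \<Longrightarrow> \<omega> \<in> space M \<Longrightarrow> \<bar>g j \<omega>\<bar> \<le> B"
  shows "integrable M (\<lambda>\<omega>. (\<Sum>j<N. g j \<omega> * (W (t (Suc j)) \<omega> - W (t j) \<omega>))\<^sup>2) \<and>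
    expectation (\<lambda>\<omega>. (\<Sum>j<N. g j \<omega> * (W (t (Suc j)) \<omega> - W (t j) \<omega>))\<^sup>2)
      = expectation (\<lambda>\<omega>. \<Sum>j<N. (g j \<omega>)\<^sup>2 * (t (Suc j) - t j))"
  using t g B
proof (induction N)
  case 0
  then show ?case by simp
next
  case (Suc N)
  let ?G = "\<lambda>\<omega>. \<Sum>j<N. g j \<omega> * (W (t (Suc j)) \<omega> - W (t j) \<omega>)"
  let ?D = "\<lambda>\<omega>. W (t (Suc N)) \<omega> - W (t N) \<omega>"
  have IH: "integrable M (\<lambda>\<omega>. (?G \<omega>)\<^sup>2)"
    "expectation (\<lambda>\<omega>. (?G \<omega>)\<^sup>2) = expectation (\<lambda>\<omega>. \<Sum>j<N. (g j \<omega>)\<^sup>2 * (t (Suc j) - t j))"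
    using Suc by auto
  have mono_t: "t i \<le> t j" if "i \<le> j" "j \<le> Suc N" for i j
    using that
  proof (induction j)
    case (Suc j)
    then show ?case using Suc.prems(2) \<open>\<And>j. j < Suc N \<Longrightarrow> t j < t (Suc j)\<close>[of j]
      by (cases "i = Suc j") auto
  qed simp
  have t0: "0 \<le> t j" if "j \<le> Suc N" for j
    using mono_t[of 0 j] that Suc.prems(1) by simp
  have WF: "W (t j) \<in> borel_measurable (F (t j))" if "j \<le> Suc N" for j
    using W t0[OF that] by (auto simp: brownian_motion_def adapted_process_def)
  have WN: "W (t j) \<in> borel_measurable (F (t N))" if "j \<le> N" for j
    using measurable_F_mono[OF t0 mono_t WF, of j N] that by simp
  have gN: "g j \<in> borel_measurable (F (t N))" if "j \<le> N" for j
    using measurable_F_mono[OF t0 mono_t Suc.prems(3), of j N] that by simp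
  have GN[measurable]: "?G \<in> borel_measurable (F (t N))"
    using WN gN by (intro borel_measurable_sum borel_measurable_times borel_measurable_diff) auto
  have gNN[measurable]: "g N \<in> borel_measurable (F (t N))"
    using gN by simp
  have GM[measurable]: "?G \<in> borel_measurable M" and [measurable]: "g N \<in> borel_measurable M"
    by (rule measurable_F_M[OF t0[of N]], simp, fact)+
  have Bsq: "AE \<omega> in M. norm ((g j \<omega>)\<^sup>2) \<le> B\<^sup>2" if "j \<le> N" for j
    using Suc.prems(4)[of j] that by (intro AE_I2) (auto simp: abs_le_square_iff[symmetric] intro: order_trans[OF _ abs_ge_self])
  have gint: "integrable M (\<lambda>\<omega>. (g j \<omega>)\<^sup>2)" if "j \<le> N" for j
    using measurable_F_M[OF t0[of N] gN[OF that]] Bsq[OF that]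
    by (intro integrable_const_bound[where B = "B\<^sup>2"]) auto
  have "integrable M ?G"
    using GM IH(1) by (rule square_integrable_imp_integrable)
  then have "integrable M (\<lambda>\<omega>. B * ?G \<omega>)"
    by simp
  then have Ggint: "integrable M (\<lambda>\<omega>. g N \<omega> * ?G \<omega>)"
  proof (rule Bochner_Integration.integrable_bound)
    have "\<bar>g N \<omega>\<bar> * \<bar>?G \<omega>\<bar> \<le> \<bar>B\<bar> * \<bar>?G \<omega>\<bar>" if "\<omega> \<in> space M" for \<omega>
      using Suc.prems(4)[of N \<omega>] that by (intro mult_right_mono) auto
    then show "AE \<omega> in M. norm (g N \<omega> * ?G \<omega>) \<le> norm (B * ?G \<omega>)"
      by (intro AE_I2) (simp only: real_norm_def abs_mult)
  qed measurable
  have tN: "0 \<le> t N" "t N < t (Suc N)"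
    using t0[of N] Suc.prems(2)[of N] by simp_all
  have m1: "(\<lambda>\<omega>. g N \<omega> * ?G \<omega>) \<in> borel_measurable (F (t N))"
    using gNN GN by (rule borel_measurable_times)
  have m2: "(\<lambda>\<omega>. (g N \<omega>)\<^sup>2) \<in> borel_measurable (F (t N))"
    using gNN by (rule borel_measurable_power)
  note cross = brownian_increment(1,2)[OF W tN m1 Ggint]
  note sq = brownian_increment(3,4)[OF W tN m2 gint[OF order_refl]]
  have "(a + b * d)\<^sup>2 = a\<^sup>2 + 2 * (b * a * d) + b\<^sup>2 * d\<^sup>2" for a b d :: real
    by (simp add: power2_eq_square algebra_simps)
  then have eq: "(\<Sum>j<Suc N. g j \<omega> * (W (t (Suc j)) \<omega> - W (t j) \<omega>))\<^sup>2
      = (?G \<omega>)\<^sup>2 + 2 * (g N \<omega> * ?G \<omega> * ?D \<omega>) + (g N \<omega>)\<^sup>2 * (?D \<omega>)\<^sup>2" for \<omega>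
    by (simp only: sum.lessThan_Suc)
  have int2: "integrable M (\<lambda>\<omega>. 2 * (g N \<omega> * ?G \<omega> * ?D \<omega>))"
    using cross(1) by (rule integrable_mult_right)
  have intS: "integrable M (\<lambda>\<omega>. \<Sum>j<N. (g j \<omega>)\<^sup>2 * (t (Suc j) - t j))"
    using gint by (intro Bochner_Integration.integrable_sum integrable_mult_left) simp
  have intN: "integrable M (\<lambda>\<omega>. (g N \<omega>)\<^sup>2 * (t (Suc N) - t N))"
    using gint by (intro integrable_mult_left) simp
  have int12: "integrable M (\<lambda>\<omega>. (?G \<omega>)\<^sup>2 + 2 * (g N \<omega> * ?G \<omega> * ?D \<omega>))"
    using IH(1) int2 by (rule Bochner_Integration.integrable_add)
  have "expectation (\<lambda>\<omega>. (?G \<omega>)\<^sup>2 + 2 * (g N \<omega> * ?G \<omega> * ?D \<omega>) + (g N \<omega>)\<^sup>2 * (?D \<omega>)\<^sup>2)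
      = expectation (\<lambda>\<omega>. (?G \<omega>)\<^sup>2) + 2 * expectation (\<lambda>\<omega>. g N \<omega> * ?G \<omega> * ?D \<omega>)
        + expectation (\<lambda>\<omega>. (g N \<omega>)\<^sup>2 * (?D \<omega>)\<^sup>2)"
    by (simp only: Bochner_Integration.integral_add[OF int12 sq(1)]
        Bochner_Integration.integral_add[OF IH(1) int2] integral_mult_right_zero)
  also have "\<dots> = expectation (\<lambda>\<omega>. \<Sum>j<N. (g j \<omega>)\<^sup>2 * (t (Suc j) - t j))
      + expectation (\<lambda>\<omega>. (g N \<omega>)\<^sup>2 * (t (Suc N) - t N))"
    by (simp only: cross(2) sq(2) IH(2) integral_mult_left_zero mult_zero_right add_0_right)
  also have "\<dots> = expectation (\<lambda>\<omega>. \<Sum>j<Suc N. (g j \<omega>)\<^sup>2 * (t (Suc j) - t j))"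
    by (simp only: Bochner_Integration.integral_add[OF intS intN] sum.lessThan_Suc)
  finally show ?case
    unfolding eq using Bochner_Integration.integrable_add[OF int12 sq(1)] by simp
qed

text \<open>Switching the integrand off as soon as its quadratic energy exceeds \<open>\<delta>\<close> makes the isometry
  applicable.\<close>

lemma elementary_integral_tail:
  fixes \<delta> \<epsilon> :: real
  assumes W: "brownian_motion M F W" and t: "0 \<le> t 0" "\<And>j. j < N \<Longrightarrow> t j < t (Suc j)"
    and g: "\<And>j. j < N \<Longrightarrow> g j \<in> borel_measurable (F (t j))"
    and B: "\<And>j \<omega>. j < N \<Longrightarrow> \<omega> \<in> space M \<Longrightarrow> \<bar>g j \<omega>\<bar> \<le> B"
    and "0 \<le> \<delta>" "0 < \<epsilon>"
  shows "\<exists>E\<in>sets M. measure M E \<le> \<delta> / \<epsilon>\<^sup>2 \<and>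
    (\<forall>\<omega>\<in>space M. (\<Sum>j<N. (g j \<omega>)\<^sup>2 * (t (Suc j) - t j)) \<le> \<delta> \<longrightarrow>
       \<epsilon> < \<bar>\<Sum>j<N. g j \<omega> * (W (t (Suc j)) \<omega> - W (t j) \<omega>)\<bar> \<longrightarrow> \<omega> \<in> E)"
proof -
  have mono_t: "t i \<le> t j" if "i \<le> j" "j \<le> N" for i j
    using that
  proof (induction j)
    case (Suc j)
    then show ?case using t(2)[of j] by (cases "i = Suc j") auto
  qed simp
  have t0: "0 \<le> t j" if "j \<le> N" for j
    using mono_t[of 0 j] that t(1) by simp
  define S where "S n \<omega> = (\<Sum>j<n. (g j \<omega>)\<^sup>2 * (t (Suc j) - t j))" for n \<omega>
  \<comment> \<open>The test uses \<open>S (Suc j)\<close>, the energy including the current cell.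
    It is still known at time \<open>t j\<close>, as the cell length is deterministic, and it
    prevents any overshoot above \<open>\<delta>\<close>.\<close>
  define h where "h j \<omega> = (if S (Suc j) \<omega> \<le> \<delta> then g j \<omega> else 0)" for j \<omega>
  have S_mono: "S m \<omega> \<le> S n \<omega>" if "m \<le> n" "n \<le> N" for m n \<omega>
    unfolding S_def using that t(2) by (intro sum_mono2) (auto simp: less_imp_le)
  have h_meas: "h j \<in> borel_measurable (F (t j))" if j: "j < N" for j
  proof -
    have "g i \<in> borel_measurable (F (t j))" if "i \<le> j" for i
      using measurable_F_mono[OF t0 mono_t g, of i j] that j by simp
    then have [measurable]: "S (Suc j) \<in> borel_measurable (F (t j))" "g j \<in> borel_measurable (F (t j))"
      unfolding S_def[abs_def]
      by (auto intro!: borel_measurable_sum borel_measurable_times borel_measurable_power)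
    show ?thesis unfolding h_def[abs_def] by measurable
  qed
  have h_bound: "\<bar>h j \<omega>\<bar> \<le> B" if "j < N" "\<omega> \<in> space M" for j \<omega>
    using B[OF that] by (auto simp: h_def)
  let ?H = "\<lambda>\<omega>. \<Sum>j<N. h j \<omega> * (W (t (Suc j)) \<omega> - W (t j) \<omega>)"
  note iso = elementary_integral_isometry[where g = h and N = N and B = B, OF W t h_meas h_bound]
  have int: "integrable M (\<lambda>\<omega>. (?H \<omega>)\<^sup>2)"
    using iso by simp
  \<comment> \<open>The bound by \<open>S n\<close> strengthens the induction: while the integrand
    is on, the next cell turns it into the bound by \<open>S (Suc n)\<close>, which is then at most
    \<open>\<delta>\<close>.\<close>
  have energy: "(\<Sum>j<n. (h j \<omega>)\<^sup>2 * (t (Suc j) - t j)) \<le> min \<delta> (S n \<omega>)" if "n \<le> N" for n \<omega>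
    using that
  proof (induction n)
    case 0
    then show ?case using \<open>0 \<le> \<delta>\<close> by (simp add: S_def)
  next
    case (Suc n)
    show ?case
    proof (cases "S (Suc n) \<omega> \<le> \<delta>")
      case True
      then show ?thesis using Suc by (simp add: h_def S_def)
    next
      case False
      then show ?thesis using Suc S_mono[of n "Suc n" \<omega>] by (simp add: h_def)
    qed
  qed
  have "expectation (\<lambda>\<omega>. \<Sum>j<N. (h j \<omega>)\<^sup>2 * (t (Suc j) - t j)) \<le> expectation (\<lambda>\<omega>. \<delta>)"
  proof (rule integral_mono')
    show "(\<Sum>j<N. (h j \<omega>)\<^sup>2 * (t (Suc j) - t j)) \<le> \<delta>" for \<omega>
      using energy[of N \<omega>] by simp
  qed (use \<open>0 \<le> \<delta>\<close> in auto)
  then have le: "expectation (\<lambda>\<omega>. (?H \<omega>)\<^sup>2) \<le> \<delta>"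
    using iso by (simp add: prob_space)
  have "W (t j) \<in> borel_measurable M" if "j \<le> N" for j
    using W t0[OF that] by (auto simp: brownian_motion_def intro: adapted_measurable)
  then have [measurable]: "?H \<in> borel_measurable M"
    by (intro borel_measurable_sum borel_measurable_times borel_measurable_diff)
      (auto intro: measurable_F_M[OF t0 h_meas])
  let ?E = "{\<omega>\<in>space M. (?H \<omega>)\<^sup>2 \<ge> \<epsilon>\<^sup>2}"
  have "measure M ?E \<le> expectation (\<lambda>\<omega>. (?H \<omega>)\<^sup>2) / \<epsilon>\<^sup>2"
    using int \<open>0 < \<epsilon>\<close> by (intro integral_Markov_inequality_measure[where A = "{}"]) auto
  also have "\<dots> \<le> \<delta> / \<epsilon>\<^sup>2"
    using le by (intro divide_right_mono) auto
  finally have "measure M ?E \<le> \<delta> / \<epsilon>\<^sup>2" .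
  moreover have "\<omega> \<in> ?E" if "\<omega> \<in> space M" "S N \<omega> \<le> \<delta>"
    and gt: "\<epsilon> < \<bar>\<Sum>j<N. g j \<omega> * (W (t (Suc j)) \<omega> - W (t j) \<omega>)\<bar>" for \<omega>
  proof -
    have "h j \<omega> = g j \<omega>" if "j < N" for j
      using S_mono[of "Suc j" N \<omega>] \<open>S N \<omega> \<le> \<delta>\<close> that by (simp add: h_def)
    then have "\<epsilon> < \<bar>?H \<omega>\<bar>"
      using gt by simp
    then show ?thesis
      using \<open>0 < \<epsilon>\<close> that(1) by (simp add: abs_le_square_iff[symmetric])
  qed
  ultimately show ?thesis
    by (intro bexI[of _ ?E]) (auto simp: S_def)
qed

end

section \<open>Common refinements of simple processes\<close>

text \<open>Sorting the points without repetition makes the steps strict. This matters because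
  simple processes may repeat times, while \<open>brownian_motion\<close> describes increments only
  for \<open>s < t\<close>.\<close>

lemma ex_strict_grid:
  fixes q r :: real
  assumes "finite S" "q < r"
  obtains N and t :: "nat \<Rightarrow> real" where "t 0 = q" "t N = r" "\<forall>j<N. t j < t (Suc j)"
    "S \<inter> {q..r} \<subseteq> t ` {..N}"
proof
  define xs where "xs = sorted_list_of_set (insert q (insert r (S \<inter> {q..r})))"
  have set: "set xs = insert q (insert r (S \<inter> {q..r}))"
    unfolding xs_def using \<open>finite S\<close> by (intro set_sorted_list_of_set) simp
  have sorted: "xs ! i < xs ! j" if "i < j" "j < length xs" for i j
    using that unfolding xs_def by (rule sorted_wrt_nth_less[OF strict_sorted_list_of_set])
  have range: "q \<le> xs ! i" "xs ! i \<le> r" if "i < length xs" for i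
    using nth_mem[OF that] set \<open>q < r\<close> by auto
  obtain i where i: "i < length xs" "xs ! i = q"
    using set by (metis in_set_conv_nth insertI1)
  obtain j where j: "j < length xs" "xs ! j = r"
    using set by (metis in_set_conv_nth insertI1 insertI2)
  have "0 < length xs"
    using i by auto
  then show "xs ! 0 = q"
    using i sorted[of 0 i] range(1)[of 0] by (cases "i = 0") auto
  show "xs ! (length xs - 1) = r"
  proof (rule antisym)
    have "length xs - 1 < length xs"
      using j(1) by linarith
    then show "xs ! (length xs - 1) \<le> r"
      by (rule range(2))
    show "r \<le> xs ! (length xs - 1)"
      using j sorted[of j "length xs - 1"] \<open>length xs - 1 < length xs\<close>
      by (cases "j = length xs - 1") (simp_all add: less_imp_le)
  qed
  show "\<forall>n<length xs - 1. xs ! n < xs ! Suc n"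
    using sorted by simp
  show "S \<inter> {q..r} \<subseteq> (!) xs ` {..length xs - 1}"
  proof
    fix u assume "u \<in> S \<inter> {q..r}"
    then have "u \<in> set xs"
      using set by simp
    then obtain n where "n < length xs" "xs ! n = u"
      by (metis in_set_conv_nth)
    then show "u \<in> (!) xs ` {..length xs - 1}"
      by (intro image_eqI[of _ _ n]) auto
  qed
qed

locale time_grid =
  fixes t :: "nat \<Rightarrow> real" and N :: nat
  assumes step: "j < N \<Longrightarrow> t j < t (Suc j)"
begin

lemma less: "i < j \<Longrightarrow> j \<le> N \<Longrightarrow> t i < t j"
proof (induction j)
  case (Suc j)
  then show ?case
    using step[of j] by (cases "i = j") auto
qed simp

lemma le: "i \<le> j \<Longrightarrow> j \<le> N \<Longrightarrow> t i \<le> t j"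
  using less[of i j] by (cases "i = j") auto

lemma le_iff: "i \<le> N \<Longrightarrow> j \<le> N \<Longrightarrow> t i \<le> t j \<longleftrightarrow> i \<le> j"
  by (metis le less not_le)

lemma sum_increments_below:
  assumes "n \<le> N"
  shows "(\<Sum>j<N. if t (Suc j) \<le> t n then f (t (Suc j)) - f (t j) else (0::real)) = f (t n) - f (t 0)"
proof -
  have "(\<Sum>j<N. if t (Suc j) \<le> t n then f (t (Suc j)) - f (t j) else 0)
      = (\<Sum>j<N. if j < n then f (t (Suc j)) - f (t j) else 0)"
    using assms by (intro sum.cong) (auto simp: le_iff Suc_le_eq)
  also have "\<dots> = (\<Sum>j<n. f (t (Suc j)) - f (t j))"
    using assms by (intro sum.mono_neutral_cong_right) auto
  also have "\<dots> = f (t n) - f (t 0)"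
    by (rule sum_lessThan_telescope)
  finally show ?thesis .
qed

text \<open>A telescoping sum, which is empty for \<open>u\<close> before the grid and full for
  \<open>u\<close> after it. The clipped form on the right is the one produced by
  \<open>min (\<tau> i) t\<close> in \<open>simple_integral\<close>.\<close>

lemma sum_increments_clip:
  assumes u: "t 0 \<le> u \<Longrightarrow> u \<le> t N \<Longrightarrow> u \<in> t ` {..N}"
  shows "(\<Sum>j<N. if t (Suc j) \<le> u then f (t (Suc j)) - f (t j) else (0::real))
    = f (min u (t N)) - f (min u (t 0))"
proof -
  consider "u < t 0" | "t N < u" | n where "n \<le> N" "u = t n"
    using u by fastforce
  then show ?thesis
  proof cases
    case 1
    then have "\<not> t (Suc j) \<le> u" if "j < N" for j
      using le[of 0 "Suc j"] that by simp
    then show ?thesis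
      using 1 le[of 0 N] by simp
  next
    case 2
    have "t (Suc j) \<le> t N" "t (Suc j) \<le> u" if "j < N" for j
      using 2 le[of "Suc j" N] that by auto
    then have "(\<Sum>j<N. if t (Suc j) \<le> u then f (t (Suc j)) - f (t j) else 0)
        = (\<Sum>j<N. if t (Suc j) \<le> t N then f (t (Suc j)) - f (t j) else 0)"
      by (intro sum.cong) auto
    then show ?thesis
      using 2 sum_increments_below[of N f] le[of 0 N] by simp
  next
    case 3
    then show ?thesis
      using sum_increments_below[of n f] le[of n N] le[of 0 n] by (simp add: min_def)
  qed
qed

text \<open>The half-open cells are disjoint, so the step function with values
  \<open>(d j)\<^sup>2\<close> lies pointwise below the integrand. Monotonicity of the integral then
  gives this one-sided bound for an arbitrary function \<open>D\<close>.\<close>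

lemma energy_le_nn_integral:
  assumes D: "\<And>j s. j < N \<Longrightarrow> t j < s \<Longrightarrow> s \<le> t (Suc j) \<Longrightarrow> D s = d j"
  shows "ennreal (\<Sum>j<N. (d j)\<^sup>2 * (t (Suc j) - t j)) \<le> (\<integral>\<^sup>+ s\<in>{t 0..t N}. ennreal ((D s)\<^sup>2) \<partial>lborel)"
proof -
  have "ennreal (\<Sum>j<N. (d j)\<^sup>2 * (t (Suc j) - t j))
      = (\<Sum>j<N. ennreal ((d j)\<^sup>2) * emeasure lborel {t j<..t (Suc j)})"
    using step by (subst sum_ennreal[symmetric]) (auto simp: less_imp_le ennreal_mult)
  also have "\<dots> = (\<Sum>j<N. \<integral>\<^sup>+ s. ennreal ((d j)\<^sup>2) * indicator {t j<..t (Suc j)} s \<partial>lborel)"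
    by (simp add: nn_integral_cmult_indicator)
  also have "\<dots> = (\<integral>\<^sup>+ s. (\<Sum>j<N. ennreal ((d j)\<^sup>2) * indicator {t j<..t (Suc j)} s) \<partial>lborel)"
    by (rule nn_integral_sum[symmetric]) simp
  also have "\<dots> \<le> (\<integral>\<^sup>+ s\<in>{t 0..t N}. ennreal ((D s)\<^sup>2) \<partial>lborel)"
  proof (rule nn_integral_mono)
    fix s :: real
    let ?f = "\<lambda>j. ennreal ((d j)\<^sup>2) * indicator {t j<..t (Suc j)} s"
    show "(\<Sum>j<N. ?f j) \<le> ennreal ((D s)\<^sup>2) * indicator {t 0..t N} s"
    proof (cases "\<exists>j<N. s \<in> {t j<..t (Suc j)}")
      case True
      then obtain j where j: "j < N" "s \<in> {t j<..t (Suc j)}"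
        by blast
      have "s \<notin> {t i<..t (Suc i)}" if "i < N" "i \<noteq> j" for i
        using le[of "Suc i" j] le[of "Suc j" i] that j by (cases "i < j") auto
      then have "(\<Sum>i<N. ?f i) = ?f j"
        using j by (subst sum.remove[of _ j]) (auto intro!: sum.neutral)
      moreover have "t 0 \<le> s" "s \<le> t N"
        using j le[of 0 j] le[of "Suc j" N] by auto
      ultimately show ?thesis
        using j D[of j s] by simp
    next
      case False
      then have "(\<Sum>i<N. ?f i) = 0"
        by (intro sum.neutral) auto
      then show ?thesis by simp
    qed
  qed
  finally show ?thesis .
qed

end

text \<open>The grid will cover only \<open>[q, r]\<close>, whereas the jump times
  \<open>\<tau>\<close> may lie on either side of it; only those inside have to be grid
  points.\<close>

locale refining_grid = time_grid t N for t :: "nat \<Rightarrow> real" and N +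
  fixes \<tau> :: "nat \<Rightarrow> real" and k :: nat
  assumes refines: "i \<le> k \<Longrightarrow> t 0 \<le> \<tau> i \<Longrightarrow> \<tau> i \<le> t N \<Longrightarrow> \<tau> i \<in> t ` {..N}"
    and \<tau>_mono: "i < k \<Longrightarrow> \<tau> i \<le> \<tau> (Suc i)"
begin

lemma separated: "i \<le> k \<Longrightarrow> j < N \<Longrightarrow> \<tau> i \<le> t j \<or> t (Suc j) \<le> \<tau> i"
proof (rule ccontr)
  assume i: "i \<le> k" and j: "j < N" and *: "\<not> (\<tau> i \<le> t j \<or> t (Suc j) \<le> \<tau> i)"
  then have "\<tau> i \<in> t ` {..N}"
    using le[of 0 j] le[of "Suc j" N] by (intro refines) auto
  then obtain n where "n \<le> N" "\<tau> i = t n"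
    by auto
  then show False
    using * le_iff[of n j] le_iff[of "Suc j" n] j by auto
qed

lemma simple_value_const:
  assumes j: "j < N" and s: "t j < s" "s \<le> t (Suc j)"
  shows "simple_value k \<tau> \<xi> s \<omega> = simple_value k \<tau> \<xi> (t (Suc j)) \<omega>"
proof -
  have "indicator {\<tau> i<..\<tau> (Suc i)} s = (indicator {\<tau> i<..\<tau> (Suc i)} (t (Suc j)) :: real)" if "i < k" for i
    using separated[of i j] separated[of "Suc i" j] that j s by (auto simp: indicator_def)
  then show ?thesis
    by (simp add: simple_value_def)
qed

text \<open>On a grid cell, the indicator of \<open>(\<tau> i, \<tau> (Suc i)]\<close> is the
  difference of the indicators of "cell before \<open>\<tau> (Suc i)\<close>" and "cell before
  \<open>\<tau> i\<close>". Each of these telescopes to a clipped increment of \<open>W\<close>, and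
  exchanging the two sums gives the claim.\<close>

lemma simple_integral_increment:
  "simple_integral W k \<tau> \<xi> (t N) \<omega> - simple_integral W k \<tau> \<xi> (t 0) \<omega>
    = (\<Sum>j<N. simple_value k \<tau> \<xi> (t (Suc j)) \<omega> * (W (t (Suc j)) \<omega> - W (t j) \<omega>))"
proof -
  let ?\<Delta> = "\<lambda>j. W (t (Suc j)) \<omega> - W (t j) \<omega>"
  let ?c = "\<lambda>i. W (min (\<tau> i) (t N)) \<omega> - W (min (\<tau> i) (t 0)) \<omega>"
  let ?e = "\<lambda>i j. if t (Suc j) \<le> \<tau> i then ?\<Delta> j else 0"
  have c: "(\<Sum>j<N. ?e i j) = ?c i" if "i \<le> k" for i
    using sum_increments_clip[where f = "\<lambda>u. W u \<omega>", OF refines[OF that]] .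
  have e: "indicator {\<tau> i<..\<tau> (Suc i)} (t (Suc j)) * ?\<Delta> j = ?e (Suc i) j - ?e i j"
    if "i < k" "j < N" for i j
    using separated[of i j] \<tau>_mono[of i] step[of j] that by (auto simp: indicator_def)
  have "simple_integral W k \<tau> \<xi> (t N) \<omega> - simple_integral W k \<tau> \<xi> (t 0) \<omega>
      = (\<Sum>i<k. \<xi> i \<omega> * (?c (Suc i) - ?c i))"
    by (simp add: simple_integral_def sum_subtractf[symmetric] algebra_simps)
  also have "\<dots> = (\<Sum>i<k. \<xi> i \<omega> * (\<Sum>j<N. ?e (Suc i) j - ?e i j))"
    using c by (simp add: sum_subtractf)
  also have "\<dots> = (\<Sum>i<k. \<Sum>j<N. \<xi> i \<omega> * (indicator {\<tau> i<..\<tau> (Suc i)} (t (Suc j)) * ?\<Delta> j))"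
    unfolding sum_distrib_left by (intro sum.cong refl) (simp add: e)
  also have "\<dots> = (\<Sum>j<N. simple_value k \<tau> \<xi> (t (Suc j)) \<omega> * ?\<Delta> j)"
    by (subst sum.swap) (simp only: simple_value_def sum_distrib_right mult.assoc)
  finally show ?thesis .
qed

end

lemma simple_process_time_nonneg:
  assumes "simple_process M F k \<tau> \<xi>" "i \<le> k"
  shows "0 \<le> \<tau> i"
  using assms(2)
proof (induction i)
  case (Suc i)
  then have "\<tau> i \<le> \<tau> (Suc i)"
    using assms(1) by (simp add: simple_process_def)
  with Suc show ?case by simp
qed (use assms(1) in \<open>simp add: simple_process_def\<close>)

text \<open>The value on a cell, read off at its right end, is known at its left end: a term
  contributes only if \<open>\<tau> i < t (Suc j)\<close>, and then
  \<open>\<tau> i \<le> t j\<close> because no jump time lies strictly inside a cell.\<close>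

lemma (in stochastic_basis) simple_value_predictable:
  assumes "refining_grid t N \<tau> k" and sp: "simple_process M F k \<tau> \<xi>" and j: "j < N" "0 \<le> t j"
  shows "simple_value k \<tau> \<xi> (t (Suc j)) \<in> borel_measurable (F (t j))"
proof -
  interpret refining_grid t N \<tau> k by fact
  note \<tau>0 = simple_process_time_nonneg[OF sp]
  have "(\<lambda>\<omega>. \<xi> i \<omega> * indicator {\<tau> i<..\<tau> (Suc i)} (t (Suc j))) \<in> borel_measurable (F (t j))"
    if i: "i < k" for i
  proof (cases "\<tau> i < t (Suc j)")
    case True
    then have "\<tau> i \<le> t j"
      using separated[of i j] i j by auto
    moreover have "\<xi> i \<in> borel_measurable (F (\<tau> i))"
      using sp i by (simp add: simple_process_def)
    ultimately have "\<xi> i \<in> borel_measurable (F (t j))"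
      using \<tau>0[of i] i by (auto intro: measurable_F_mono)
    then show ?thesis by simp
  qed simp
  then show ?thesis
    unfolding simple_value_def[abs_def] by (intro borel_measurable_sum) auto
qed

lemma simple_value_bounded:
  assumes "simple_process M F k \<tau> \<xi>"
  obtains B where "\<forall>\<omega>\<in>space M. \<forall>s. \<bar>simple_value k \<tau> \<xi> s \<omega>\<bar> \<le> B"
proof -
  obtain b where b: "\<bar>\<xi> i \<omega>\<bar> \<le> b i" if "i < k" "\<omega> \<in> space M" for i \<omega>
    using assms unfolding simple_process_def by metis
  have "\<bar>simple_value k \<tau> \<xi> s \<omega>\<bar> \<le> (\<Sum>i<k. b i)" if "\<omega> \<in> space M" for s \<omega>
    unfolding simple_value_def using b that
    by (intro order_trans[OF sum_abs] sum_mono) (force simp: abs_mult indicator_def)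
  then show ?thesis by (intro that[of "\<Sum>i<k. b i"]) blast
qed

section \<open>Approximation of the Ito integral\<close>

text \<open>Turns an event about all times in \<open>[0, T]\<close> into a countable union of
  measurable ones. Clamping the rationals to \<open>[0, T]\<close> also reaches an irrational
  endpoint \<open>T\<close>.\<close>

lemma ex_greater_iff_ex_rat:
  fixes f :: "real \<Rightarrow> real"
  assumes f: "continuous_on {0..T} f" and T: "0 \<le> T"
  shows "(\<exists>t\<in>{0..T}. c < f t) \<longleftrightarrow> (\<exists>u\<in>\<rat>. c < f (max 0 (min T u)))"
proof
  assume "\<exists>t\<in>{0..T}. c < f t"
  then obtain t where t: "t \<in> {0..T}" "c < f t"
    by blast
  let ?g = "\<lambda>u. f (max 0 (min T u))"
  have "continuous_on UNIV ?g"
    using T by (intro continuous_on_compose2[OF f] continuous_intros) auto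
  then have "open (?g -` {c<..})"
    by (intro open_vimage) auto
  moreover have "t \<in> ?g -` {c<..}"
    using t by simp
  ultimately obtain e where e: "0 < e" "ball t e \<subseteq> ?g -` {c<..}"
    by (meson open_contains_ball)
  obtain u where "u \<in> \<rat>" "t < u" "u < t + e"
    using Rats_dense_in_real[of t "t + e"] e by auto
  moreover have "u \<in> ball t e"
    using calculation by (simp add: dist_real_def)
  ultimately show "\<exists>u\<in>\<rat>. c < ?g u"
    using e by auto
qed (use T in auto)

text \<open>The points violating \<open>Q\<close> lie in every \<open>E n\<close>, hence in a null
  intersection. They are covered rather than measured, so \<open>Q\<close> may involve a pathwise
  condition such as equality of two integrands at every time of an interval.\<close>

lemma (in finite_measure) AE_if_small_exceptional_sets:
  assumes small: "\<And>\<eta>. 0 < \<eta> \<Longrightarrow> \<exists>E\<in>sets M. measure M E \<le> \<eta> \<and> (\<forall>\<omega>\<in>space M - E. Q \<omega>)"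
  shows "AE \<omega> in M. Q \<omega>"
proof -
  obtain E where E: "E n \<in> sets M" "measure M (E n) \<le> 1 / real (Suc n)" "\<forall>\<omega>\<in>space M - E n. Q \<omega>" for n
    using small[of "1 / real (Suc _)"] by (metis divide_pos_pos of_nat_0_less_iff zero_less_Suc zero_less_one)
  have "measure M (\<Inter>n. E n) \<le> 1 / real (Suc n)" for n
    using E by (intro order_trans[OF finite_measure_mono E(2)]) auto
  then have "measure M (\<Inter>n. E n) \<le> 0"
    using LIMSEQ_inverse_real_of_nat
    by (intro LIMSEQ_le_const[of "\<lambda>n. 1 / real (Suc n)"]) (auto simp: inverse_eq_divide)
  then have "measure M (\<Inter>n. E n) = 0"
    by (simp add: antisym)
  then have "(\<Inter>n. E n) \<in> null_sets M"
    using E(1) by (auto simp: null_sets_def emeasure_eq_measure)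
  then show ?thesis
    by (rule AE_I') (use E(3) in auto)
qed

lemma (in finite_measure) AE_eq_0_if_small_exceptional_sets:
  fixes Z :: "'a \<Rightarrow> real"
  assumes small: "\<And>\<epsilon> \<eta>. 0 < \<epsilon> \<Longrightarrow> 0 < \<eta> \<Longrightarrow>
    \<exists>E\<in>sets M. measure M E \<le> \<eta> \<and> (\<forall>\<omega>\<in>space M - E. Q \<omega> \<longrightarrow> \<bar>Z \<omega>\<bar> \<le> \<epsilon>)"
  shows "AE \<omega> in M. Q \<omega> \<longrightarrow> Z \<omega> = 0"
proof -
  have "AE \<omega> in M. Q \<omega> \<longrightarrow> \<bar>Z \<omega>\<bar> \<le> 1 / real (Suc n)" for n
    using small[of "1 / real (Suc n)"] by (intro AE_if_small_exceptional_sets) simp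
  then have "AE \<omega> in M. \<forall>n. Q \<omega> \<longrightarrow> \<bar>Z \<omega>\<bar> \<le> 1 / real (Suc n)"
    by (rule AE_all_countable[THEN iffD2, OF allI])
  then show ?thesis
  proof (rule AE_mp, intro AE_I2 impI)
    fix \<omega> assume "\<forall>n. Q \<omega> \<longrightarrow> \<bar>Z \<omega>\<bar> \<le> 1 / real (Suc n)" "Q \<omega>"
    then have "\<bar>Z \<omega>\<bar> \<le> 0"
      using LIMSEQ_inverse_real_of_nat
      by (intro LIMSEQ_le_const[of "\<lambda>n. 1 / real (Suc n)"]) (auto simp: inverse_eq_divide)
    then show "Z \<omega> = 0" by simp
  qed
qed

context stochastic_basis
begin

text \<open>Exchanges the coordinates and enlarges \<open>F T\<close> to \<open>M\<close>, the form
  in which the inner time integral is measurable in \<open>\<omega>\<close>.\<close>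

lemma progressive_measurable:
  assumes H: "progressive_process F H" and T: "0 \<le> T"
  shows "(\<lambda>(\<omega>, s). H s \<omega>) \<in> borel_measurable (M \<Otimes>\<^sub>M restrict_space lborel {0..T})"
proof -
  have H': "(\<lambda>(s, \<omega>). H s \<omega>) \<in> borel_measurable (restrict_space borel {0..T} \<Otimes>\<^sub>M F T)"
    using H T by (simp add: progressive_process_def)
  have [measurable]: "(\<lambda>\<omega>. \<omega>) \<in> measurable M (F T)"
    using subalg[OF T] by (auto simp: measurable_def subalgebra_def)
  have [measurable_cong]: "sets (restrict_space lborel {0..T}) = sets (restrict_space borel {0..T})"
    by (rule sets_restrict_space_cong) simp
  have "(\<lambda>x. (snd x, fst x)) \<in>
      measurable (M \<Otimes>\<^sub>M restrict_space lborel {0..T}) (restrict_space borel {0..T} \<Otimes>\<^sub>M F T)"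
    by measurable
  from measurable_compose[OF this H'] show ?thesis
    by (simp add: case_prod_beta')
qed

lemma progressive_path_measurable:
  assumes "progressive_process F H" "0 \<le> T" "\<omega> \<in> space M"
  shows "(\<lambda>s. H s \<omega>) \<in> borel_measurable (restrict_space lborel {0..T})"
  using measurable_compose[OF measurable_Pair1'[OF assms(3)] progressive_measurable[OF assms(1,2)]]
  by simp

lemma simple_value_measurable:
  assumes sp: "simple_process M F k \<tau> \<xi>"
  shows "(\<lambda>(\<omega>, s). simple_value k \<tau> \<xi> s \<omega>) \<in> borel_measurable (M \<Otimes>\<^sub>M restrict_space lborel {0..T})"
proof -
  note \<tau>0 = simple_process_time_nonneg[OF sp]
  have [measurable]: "\<xi> i \<in> borel_measurable M" if "i < k" for i
    using sp \<tau>0[of i] that by (auto simp: simple_process_def intro: measurable_F_M)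
  have [measurable]: "(\<lambda>s. indicator {\<tau> i<..\<tau> (Suc i)} s :: real)
      \<in> borel_measurable (restrict_space lborel {0..T})" for i
    by (rule measurable_restrict_space1) simp
  have "(\<lambda>z. \<xi> i (fst z) * indicator {\<tau> i<..\<tau> (Suc i)} (snd z))
      \<in> borel_measurable (M \<Otimes>\<^sub>M restrict_space lborel {0..T})" if "i < k" for i
    using that by measurable
  then show ?thesis
    unfolding simple_value_def[abs_def] case_prod_beta' by (intro borel_measurable_sum) auto
qed

text \<open>\<open>measure\<close> is 0 outside \<open>sets M\<close> by convention, so the limits
  in \<open>is_ito_integral\<close> carry information only for events known to be measurable. This
  lemma and \<open>integral_distance_measurable\<close> settle that for the two families of
  events.\<close>

lemma energy_distance_measurable:
  assumes "progressive_process F H" "simple_process M F k \<tau> \<xi>" "0 \<le> T"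
  shows "(\<lambda>\<omega>. \<integral>\<^sup>+ s\<in>{0..T}. ennreal ((simple_value k \<tau> \<xi> s \<omega> - H s \<omega>)\<^sup>2) \<partial>lborel) \<in> borel_measurable M"
proof -
  interpret R: sigma_finite_measure "restrict_space lborel {0..T}"
    by (rule sigma_finite_measure_restrict_space) (simp_all add: lborel.sigma_finite_measure_axioms)
  note [measurable] = progressive_measurable[OF assms(1,3)] simple_value_measurable[OF assms(2), of T]
  have "(\<lambda>\<omega>. \<integral>\<^sup>+ s. ennreal ((simple_value k \<tau> \<xi> s \<omega> - H s \<omega>)\<^sup>2) \<partial>restrict_space lborel {0..T})
      \<in> borel_measurable M"
    by measurable
  then show ?thesis
    by (simp add: nn_integral_restrict_space)
qed

lemma simple_integral_measurable:
  assumes "adapted_process F W" "simple_process M F k \<tau> \<xi>" "0 \<le> t"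
  shows "simple_integral W k \<tau> \<xi> t \<in> borel_measurable M"
proof -
  note \<tau>0 = simple_process_time_nonneg[OF assms(2)]
  have "\<xi> i \<in> borel_measurable M" if "i < k" for i
    using assms(2) \<tau>0[of i] that by (auto simp: simple_process_def intro: measurable_F_M)
  moreover have "W (min (\<tau> i) t) \<in> borel_measurable M" if "i \<le> k" for i
    using adapted_measurable[OF assms(1), of "min (\<tau> i) t"] \<tau>0[OF that] assms(3) by simp
  ultimately show ?thesis
    unfolding simple_integral_def[abs_def]
    by (intro borel_measurable_sum borel_measurable_times borel_measurable_diff) auto
qed

lemma simple_integral_continuous:
  assumes "continuous_process M W" "simple_process M F k \<tau> \<xi>" "\<omega> \<in> space M"
  shows "continuous_on {0..} (\<lambda>t. simple_integral W k \<tau> \<xi> t \<omega>)"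
proof -
  note \<tau>0 = simple_process_time_nonneg[OF assms(2)]
  have "continuous_on {0..} (\<lambda>t. W (min (\<tau> i) t) \<omega>)" if "i \<le> k" for i
    using assms(1,3) \<tau>0[OF that] unfolding continuous_process_def
    by (intro continuous_on_compose2[of "{0..}" "\<lambda>t. W t \<omega>" "{0..}" "\<lambda>t. min (\<tau> i) t"]
        continuous_on_min continuous_on_const continuous_on_id) auto
  then show ?thesis
    unfolding simple_integral_def by (intro continuous_intros) auto
qed

lemma integral_distance_measurable:
  assumes W: "adapted_process F W" "continuous_process M W"
    and I: "adapted_process F I" "continuous_process M I"
    and sp: "simple_process M F k \<tau> \<xi>" and T: "0 \<le> T"
  shows "{\<omega>\<in>space M. \<exists>t\<in>{0..T}. \<epsilon> < \<bar>simple_integral W k \<tau> \<xi> t \<omega> - I t \<omega>\<bar>} \<in> sets M"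
proof -
  let ?d = "\<lambda>t \<omega>. \<bar>simple_integral W k \<tau> \<xi> t \<omega> - I t \<omega>\<bar>"
  have "continuous_on {0..T} (\<lambda>t. ?d t \<omega>)" if "\<omega> \<in> space M" for \<omega>
    using simple_integral_continuous[OF W(2) sp that] I(2) that unfolding continuous_process_def
    by (intro continuous_intros) (auto intro: continuous_on_subset)
  then have eq: "{\<omega>\<in>space M. \<exists>t\<in>{0..T}. \<epsilon> < ?d t \<omega>}
      = (\<Union>u\<in>\<rat>. {\<omega>\<in>space M. \<epsilon> < ?d (max 0 (min T u)) \<omega>})"
    using ex_greater_iff_ex_rat[OF _ T, where f = "\<lambda>t. ?d t _"] by blast
  have "{\<omega>\<in>space M. \<epsilon> < ?d t \<omega>} \<in> sets M" if "0 \<le> t" for t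
  proof -
    have [measurable]: "simple_integral W k \<tau> \<xi> t \<in> borel_measurable M" "I t \<in> borel_measurable M"
      using simple_integral_measurable[OF W(1) sp that] adapted_measurable[OF I(1) that] by auto
    show ?thesis by measurable
  qed
  then show ?thesis
    unfolding eq by (intro sets.countable_UN' countable_rat) auto
qed

text \<open>Convergence in probability condensed into a single simple process: one late index serves
  both limits, each with exceptional probability below \<open>\<eta> / 2\<close>. The estimates for
  Ito integrals start from this form.\<close>

lemma ito_integral_approx:
  assumes W: "brownian_motion M F W" and I: "is_ito_integral M F W H I"
    and T: "0 \<le> T" and pos: "0 < \<epsilon>" "0 < \<eta>"
  obtains k \<tau> \<xi> E where "simple_process M F k \<tau> \<xi>" "E \<in> sets M" "measure M E \<le> \<eta>"
    "\<forall>\<omega>\<in>space M - E.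
      (\<integral>\<^sup>+ s\<in>{0..T}. ennreal ((simple_value k \<tau> \<xi> s \<omega> - H s \<omega>)\<^sup>2) \<partial>lborel) \<le> ennreal \<epsilon>"
    "\<forall>\<omega>\<in>space M - E. \<forall>t\<in>{0..T}. \<bar>simple_integral W k \<tau> \<xi> t \<omega> - I t \<omega>\<bar> \<le> \<epsilon>"
proof -
  obtain k \<tau> \<xi> where sp: "simple_process M F (k n) (\<tau> n) (\<xi> n)"
    and lim: "(\<lambda>n. measure M {\<omega>\<in>space M. ennreal \<epsilon> < (\<integral>\<^sup>+ s\<in>{0..T}.
        ennreal ((simple_value (k n) (\<tau> n) (\<xi> n) s \<omega> - H s \<omega>)\<^sup>2) \<partial>lborel)}) \<longlonglongrightarrow> 0"
      "(\<lambda>n. measure M {\<omega>\<in>space M.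
        \<exists>t\<in>{0..T}. \<epsilon> < \<bar>simple_integral W (k n) (\<tau> n) (\<xi> n) t \<omega> - I t \<omega>\<bar>}) \<longlonglongrightarrow> 0" for n
    using I T pos unfolding is_ito_integral_def by blast
  let ?A = "\<lambda>n. {\<omega>\<in>space M. ennreal \<epsilon> < (\<integral>\<^sup>+ s\<in>{0..T}.
        ennreal ((simple_value (k n) (\<tau> n) (\<xi> n) s \<omega> - H s \<omega>)\<^sup>2) \<partial>lborel)}"
  let ?B = "\<lambda>n. {\<omega>\<in>space M. \<exists>t\<in>{0..T}. \<epsilon> < \<bar>simple_integral W (k n) (\<tau> n) (\<xi> n) t \<omega> - I t \<omega>\<bar>}"
  have "\<forall>\<^sub>F n in sequentially. measure M (?A n) < \<eta> / 2" "\<forall>\<^sub>F n in sequentially. measure M (?B n) < \<eta> / 2"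
    using order_tendstoD(2)[OF lim(1), of "\<eta> / 2"] order_tendstoD(2)[OF lim(2), of "\<eta> / 2"] pos
    by simp_all
  then have "\<forall>\<^sub>F n in sequentially. measure M (?A n) < \<eta> / 2 \<and> measure M (?B n) < \<eta> / 2"
    by (rule eventually_conj)
  then obtain n where n: "measure M (?A n) < \<eta> / 2" "measure M (?B n) < \<eta> / 2"
    using eventually_happens' sequentially_bot by blast
  have A: "?A n \<in> sets M"
    using energy_distance_measurable[OF _ sp T, of H n] I by (auto simp: is_ito_integral_def)
  have B: "?B n \<in> sets M"
    using W I sp T unfolding brownian_motion_def is_ito_integral_def
    by (intro integral_distance_measurable) auto
  show thesis
  proof (rule that[of "k n" "\<tau> n" "\<xi> n" "?A n \<union> ?B n"])
    show "measure M (?A n \<union> ?B n) \<le> \<eta>"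
      using measure_Un_le[OF A B] n by simp
  qed (use sp A B in \<open>auto simp: not_less\<close>)
qed

end

section \<open>Locality of the Ito integral\<close>

lemma simple_process_uminus:
  "simple_process M F k \<tau> \<xi> \<Longrightarrow> simple_process M F k \<tau> (\<lambda>i \<omega>. - \<xi> i \<omega>)"
  by (auto simp: simple_process_def)

lemma simple_value_uminus: "simple_value k \<tau> (\<lambda>i \<omega>. - \<xi> i \<omega>) s \<omega> = - simple_value k \<tau> \<xi> s \<omega>"
  by (simp only: simple_value_def mult_minus_left sum_negf)

lemma simple_integral_uminus:
  "simple_integral W k \<tau> (\<lambda>i \<omega>. - \<xi> i \<omega>) t \<omega> = - simple_integral W k \<tau> \<xi> t \<omega>"
  by (simp only: simple_integral_def mult_minus_left sum_negf)

text \<open>Serves the case of a path below the level, where the Tanaka integrand is the negative of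
  the diffusion coefficient. Negating all the \<open>\<xi>\<close> keeps both distances
  unchanged.\<close>

lemma is_ito_integral_uminus:
  assumes "is_ito_integral M F W H I"
  shows "is_ito_integral M F W (\<lambda>s \<omega>. - H s \<omega>) (\<lambda>t \<omega>. - I t \<omega>)"
proof -
  have sq: "(- a - - b)\<^sup>2 = (a - b)\<^sup>2" and ab: "\<bar>- a - - b\<bar> = \<bar>a - b\<bar>" for a b :: real
    by (simp_all add: power2_commute abs_minus_commute)
  obtain k \<tau> \<xi> where sp: "\<forall>n. simple_process M F (k n) (\<tau> n) (\<xi> n)"
    and lim: "\<forall>T\<ge>0. \<forall>\<epsilon>>0.
           (\<lambda>n. measure M {\<omega>\<in>space M.
              ennreal \<epsilon> < (\<integral>\<^sup>+ s\<in>{0..T}.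
                 ennreal ((simple_value (k n) (\<tau> n) (\<xi> n) s \<omega> - H s \<omega>)\<^sup>2) \<partial>lborel)})
             \<longlonglongrightarrow> 0 \<and>
           (\<lambda>n. measure M {\<omega>\<in>space M.
              \<exists>t\<in>{0..T}. \<epsilon> < \<bar>simple_integral W (k n) (\<tau> n) (\<xi> n) t \<omega> - I t \<omega>\<bar>})
             \<longlonglongrightarrow> 0"
    using assms unfolding is_ito_integral_def by blast
  have "progressive_process F (\<lambda>s \<omega>. - H s \<omega>)"
    using assms by (simp add: is_ito_integral_def progressive_process_def case_prod_beta')
  moreover have "adapted_process F (\<lambda>t \<omega>. - I t \<omega>)"
    using assms by (simp add: is_ito_integral_def adapted_process_def)
  moreover have "continuous_process M (\<lambda>t \<omega>. - I t \<omega>)"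
    using assms by (auto simp: is_ito_integral_def continuous_process_def intro: continuous_on_minus)
  moreover have "AE \<omega> in M. \<forall>T\<ge>0. (\<integral>\<^sup>+ s\<in>{0..T}. ennreal ((- H s \<omega>)\<^sup>2) \<partial>lborel) < \<infinity>"
    using assms by (simp add: is_ito_integral_def)
  ultimately show ?thesis
    unfolding is_ito_integral_def using sp lim
    by (intro conjI exI[of _ k] exI[of _ \<tau>] exI[of _ "\<lambda>n i \<omega>. - \<xi> n i \<omega>"])
      (simp_all only: simple_process_uminus simple_value_uminus simple_integral_uminus sq ab simp_thms)
qed

context stochastic_basis
begin

text \<open>\<open>is_ito_integral\<close> does not prescribe \<open>I 0\<close>. It is inherited
  from the approximations, all of whose increments degenerate to \<open>W 0 - W 0\<close> at time
  0.\<close>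

lemma ito_integral_0:
  assumes W: "brownian_motion M F W" and I: "is_ito_integral M F W H I"
  shows "AE \<omega> in M. I 0 \<omega> = 0"
proof -
  have "AE \<omega> in M. True \<longrightarrow> I 0 \<omega> = 0"
  proof (rule AE_eq_0_if_small_exceptional_sets)
    fix \<epsilon> \<eta> :: real assume pos: "0 < \<epsilon>" "0 < \<eta>"
    obtain k \<tau> \<xi> E where sp: "simple_process M F k \<tau> \<xi>" and E: "E \<in> sets M" "measure M E \<le> \<eta>"
      and "\<forall>\<omega>\<in>space M - E.
        (\<integral>\<^sup>+ s\<in>{0..0}. ennreal ((simple_value k \<tau> \<xi> s \<omega> - H s \<omega>)\<^sup>2) \<partial>lborel) \<le> ennreal \<epsilon>"
      and close: "\<forall>\<omega>\<in>space M - E. \<forall>t\<in>{0..0}. \<bar>simple_integral W k \<tau> \<xi> t \<omega> - I t \<omega>\<bar> \<le> \<epsilon>"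
      by (rule ito_integral_approx[OF W I order_refl pos])
    have "simple_integral W k \<tau> \<xi> 0 \<omega> = 0" for \<omega>
      unfolding simple_integral_def using simple_process_time_nonneg[OF sp]
      by (intro sum.neutral) auto
    then show "\<exists>E\<in>sets M. measure M E \<le> \<eta> \<and> (\<forall>\<omega>\<in>space M - E. True \<longrightarrow> \<bar>I 0 \<omega>\<bar> \<le> \<epsilon>)"
      using E close by (intro bexI[of _ E]) auto
  qed
  then show ?thesis by simp
qed

text \<open>On a path with \<open>H = H'\<close> over \<open>[q, r]\<close>, the two simple
  approximations are close to a common function there, so their difference \<open>D\<close> has
  energy at most \<open>4 * \<epsilon>'\<close>. \<open>elementary_integral_tail\<close> bounds its
  integral on such paths outside one small set.\<close>

lemma ito_integral_local_tail:
  fixes q r \<epsilon> \<eta> :: real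
  assumes W: "brownian_motion M F W"
    and I: "is_ito_integral M F W H I" and I': "is_ito_integral M F W H' I'"
    and qr: "0 \<le> q" "q < r" and pos: "0 < \<epsilon>" "0 < \<eta>"
  shows "\<exists>E\<in>sets M. measure M E \<le> \<eta> \<and> (\<forall>\<omega>\<in>space M - E. (\<forall>s\<in>{q..r}. H s \<omega> = H' s \<omega>) \<longrightarrow>
    \<bar>(I r \<omega> - I q \<omega>) - (I' r \<omega> - I' q \<omega>)\<bar> \<le> \<epsilon>)"
proof -
  \<comment> \<open>Four approximation errors, for two integrals at two times, use up
    \<open>4 * \<epsilon>' \<le> \<epsilon> / 2\<close> and leave \<open>\<epsilon> / 2\<close> to
    the elementary integral of \<open>D\<close>. The factor 48 makes its tail probability
    \<open>16 * \<epsilon>' / \<epsilon>\<^sup>2\<close> at most \<open>\<eta> / 3\<close>.\<close>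
  define \<epsilon>' where "\<epsilon>' = min (\<epsilon> / 8) (\<eta> * \<epsilon>\<^sup>2 / 48)"
  have \<epsilon>': "0 < \<epsilon>'" "\<epsilon>' \<le> \<epsilon> / 8" "4 * \<epsilon>' / (\<epsilon> / 2)\<^sup>2 \<le> \<eta> / 3"
    using pos by (auto simp: \<epsilon>'_def field_simps power2_eq_square min_def)
  have r: "0 \<le> r" and \<eta>3: "0 < \<eta> / 3"
    using qr pos by auto
  obtain k \<tau> \<xi> E1 where sp: "simple_process M F k \<tau> \<xi>" and E1: "E1 \<in> sets M" "measure M E1 \<le> \<eta> / 3"
    and en: "\<forall>\<omega>\<in>space M - E1.
      (\<integral>\<^sup>+ s\<in>{0..r}. ennreal ((simple_value k \<tau> \<xi> s \<omega> - H s \<omega>)\<^sup>2) \<partial>lborel) \<le> ennreal \<epsilon>'"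
    and cl: "\<forall>\<omega>\<in>space M - E1. \<forall>t\<in>{0..r}. \<bar>simple_integral W k \<tau> \<xi> t \<omega> - I t \<omega>\<bar> \<le> \<epsilon>'"
    by (rule ito_integral_approx[OF W I r \<epsilon>'(1) \<eta>3])
  obtain k' \<tau>' \<xi>' E2 where sp': "simple_process M F k' \<tau>' \<xi>'"
    and E2: "E2 \<in> sets M" "measure M E2 \<le> \<eta> / 3"
    and en': "\<forall>\<omega>\<in>space M - E2.
      (\<integral>\<^sup>+ s\<in>{0..r}. ennreal ((simple_value k' \<tau>' \<xi>' s \<omega> - H' s \<omega>)\<^sup>2) \<partial>lborel) \<le> ennreal \<epsilon>'"
    and cl': "\<forall>\<omega>\<in>space M - E2. \<forall>t\<in>{0..r}. \<bar>simple_integral W k' \<tau>' \<xi>' t \<omega> - I' t \<omega>\<bar> \<le> \<epsilon>'"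
    by (rule ito_integral_approx[OF W I' r \<epsilon>'(1) \<eta>3])
  have "finite (\<tau> ` {..k} \<union> \<tau>' ` {..k'})"
    by simp
  then obtain N and t :: "nat \<Rightarrow> real" where t: "t 0 = q" "t N = r" and step: "\<forall>j<N. t j < t (Suc j)"
    and grid: "(\<tau> ` {..k} \<union> \<tau>' ` {..k'}) \<inter> {q..r} \<subseteq> t ` {..N}"
    using qr(2) by (rule ex_strict_grid)
  interpret G: refining_grid t N \<tau> k
    using t step grid sp by unfold_locales (auto simp: simple_process_def)
  interpret G': refining_grid t N \<tau>' k'
    using t step grid sp' by unfold_locales (auto simp: simple_process_def)
  define D where "D s \<omega> = simple_value k \<tau> \<xi> s \<omega> - simple_value k' \<tau>' \<xi>' s \<omega>" for s \<omega>
  obtain B where B: "\<forall>\<omega>\<in>space M. \<forall>s. \<bar>simple_value k \<tau> \<xi> s \<omega>\<bar> \<le> B"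
    using sp by (rule simple_value_bounded)
  obtain B' where B': "\<forall>\<omega>\<in>space M. \<forall>s. \<bar>simple_value k' \<tau>' \<xi>' s \<omega>\<bar> \<le> B'"
    using sp' by (rule simple_value_bounded)
  have "\<exists>E\<in>sets M. measure M E \<le> 4 * \<epsilon>' / (\<epsilon> / 2)\<^sup>2 \<and>
    (\<forall>\<omega>\<in>space M. (\<Sum>j<N. (D (t (Suc j)) \<omega>)\<^sup>2 * (t (Suc j) - t j)) \<le> 4 * \<epsilon>' \<longrightarrow>
       \<epsilon> / 2 < \<bar>\<Sum>j<N. D (t (Suc j)) \<omega> * (W (t (Suc j)) \<omega> - W (t j) \<omega>)\<bar> \<longrightarrow> \<omega> \<in> E)"
  proof (rule elementary_integral_tail[OF W])
    show "D (t (Suc j)) \<in> borel_measurable (F (t j))" if "j < N" for j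
      unfolding D_def[abs_def] using G.le[of 0 j] that t qr
      by (intro borel_measurable_diff simple_value_predictable[OF G.refining_grid_axioms sp]
          simple_value_predictable[OF G'.refining_grid_axioms sp']) auto
    show "\<bar>D (t (Suc j)) \<omega>\<bar> \<le> B + B'" if "\<omega> \<in> space M" for j \<omega>
      unfolding D_def using B B' that by (intro order_trans[OF abs_triangle_ineq4] add_mono) auto
  qed (use t step qr \<epsilon>' pos in auto)
  then obtain E3 where E3: "E3 \<in> sets M" "measure M E3 \<le> 4 * \<epsilon>' / (\<epsilon> / 2)\<^sup>2"
    and tail: "\<And>\<omega>. \<omega> \<in> space M \<Longrightarrow> (\<Sum>j<N. (D (t (Suc j)) \<omega>)\<^sup>2 * (t (Suc j) - t j)) \<le> 4 * \<epsilon>' \<Longrightarrow>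
       \<epsilon> / 2 < \<bar>\<Sum>j<N. D (t (Suc j)) \<omega> * (W (t (Suc j)) \<omega> - W (t j) \<omega>)\<bar> \<Longrightarrow> \<omega> \<in> E3"
    by blast
  have close: "\<bar>(I r \<omega> - I q \<omega>) - (I' r \<omega> - I' q \<omega>)\<bar> \<le> \<epsilon>"
    if \<omega>: "\<omega> \<in> space M" "\<omega> \<notin> E1" "\<omega> \<notin> E2" "\<omega> \<notin> E3" and eq: "\<forall>s\<in>{q..r}. H s \<omega> = H' s \<omega>" for \<omega>
  proof -
    let ?R = "restrict_space lborel {0..r}"
    let ?u = "\<lambda>s. simple_value k \<tau> \<xi> s \<omega> - H s \<omega>" and ?v = "\<lambda>s. simple_value k' \<tau>' \<xi>' s \<omega> - H' s \<omega>"
    have HH': "progressive_process F H" "progressive_process F H'"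
      using I I' by (auto simp: is_ito_integral_def)
    have [measurable]: "?u \<in> borel_measurable ?R" "?v \<in> borel_measurable ?R"
      using progressive_path_measurable[OF HH'(1) r \<omega>(1)] progressive_path_measurable[OF HH'(2) r \<omega>(1)]
        measurable_compose[OF measurable_Pair1'[OF \<omega>(1)] simple_value_measurable[OF sp]]
        measurable_compose[OF measurable_Pair1'[OF \<omega>(1)] simple_value_measurable[OF sp']]
      by (auto intro!: borel_measurable_diff)
    have const: "D s \<omega> = D (t (Suc j)) \<omega>" if "j < N" "t j < s" "s \<le> t (Suc j)" for j s
      unfolding D_def using G.simple_value_const[OF that, of \<xi>] G'.simple_value_const[OF that, of \<xi>']
      by simp
    have "ennreal (\<Sum>j<N. (D (t (Suc j)) \<omega>)\<^sup>2 * (t (Suc j) - t j))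
        \<le> (\<integral>\<^sup>+ s\<in>{q..r}. ennreal ((D s \<omega>)\<^sup>2) \<partial>lborel)"
      using G.energy_le_nn_integral[of "\<lambda>s. D s \<omega>" "\<lambda>j. D (t (Suc j)) \<omega>", OF const] t by simp
    also have "\<dots> \<le> (\<integral>\<^sup>+ s\<in>{0..r}. (2 * ennreal ((?u s)\<^sup>2) + 2 * ennreal ((?v s)\<^sup>2)) \<partial>lborel)"
    proof (rule nn_integral_mono)
      fix s :: real
      \<comment> \<open>Used with \<open>c\<close> the common value of \<open>H\<close> and
        \<open>H'\<close>; the two sides differ by \<open>(a + b - 2 * c)\<^sup>2\<close>.\<close>
      have par: "(a - b)\<^sup>2 \<le> 2 * (a - c)\<^sup>2 + 2 * (b - c)\<^sup>2" for a b c :: real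
        using zero_le_power2[of "a + b - 2 * c"] by (simp add: power2_eq_square algebra_simps)
      have "ennreal ((D s \<omega>)\<^sup>2) \<le> 2 * ennreal ((?u s)\<^sup>2) + 2 * ennreal ((?v s)\<^sup>2)" if "s \<in> {q..r}"
      proof -
        have "ennreal ((D s \<omega>)\<^sup>2) \<le> ennreal (2 * (?u s)\<^sup>2 + 2 * (?v s)\<^sup>2)"
          using par eq that unfolding D_def by (intro ennreal_leI) simp
        then show ?thesis
          by (simp add: ennreal_mult)
      qed
      then show "ennreal ((D s \<omega>)\<^sup>2) * indicator {q..r} s
          \<le> (2 * ennreal ((?u s)\<^sup>2) + 2 * ennreal ((?v s)\<^sup>2)) * indicator {0..r} s"
        using qr by (auto simp: indicator_def)
    qed
    \<comment> \<open>Additivity needs measurable integrands, and progressivity provides this only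
      on \<open>[0, r]\<close>; hence the passage to the restricted measure.\<close>
    also have "\<dots> = 2 * (\<integral>\<^sup>+ s\<in>{0..r}. ennreal ((?u s)\<^sup>2) \<partial>lborel)
        + 2 * (\<integral>\<^sup>+ s\<in>{0..r}. ennreal ((?v s)\<^sup>2) \<partial>lborel)"
      by (simp only: nn_integral_restrict_space[symmetric] sets.Int_space_eq2 space_lborel
          sets_lborel Int_UNIV_right borel_closed closed_atLeastAtMost)
        (simp add: nn_integral_add nn_integral_cmult)
    also have "\<dots> \<le> 2 * ennreal \<epsilon>' + 2 * ennreal \<epsilon>'"
      using en en' \<omega> by (intro add_mono mult_left_mono) auto
    also have "\<dots> = ennreal (4 * \<epsilon>')"
      using \<epsilon>'(1) by (simp add: ennreal_mult distrib_right[symmetric])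
    finally have "(\<Sum>j<N. (D (t (Suc j)) \<omega>)\<^sup>2 * (t (Suc j) - t j)) \<le> 4 * \<epsilon>'"
      using \<epsilon>'(1) by (subst (asm) ennreal_le_iff) auto
    then have "\<bar>\<Sum>j<N. D (t (Suc j)) \<omega> * (W (t (Suc j)) \<omega> - W (t j) \<omega>)\<bar> \<le> \<epsilon> / 2"
      using tail[OF \<omega>(1)] \<omega>(4) by (meson not_le)
    moreover have "(\<Sum>j<N. D (t (Suc j)) \<omega> * (W (t (Suc j)) \<omega> - W (t j) \<omega>))
        = (simple_integral W k \<tau> \<xi> r \<omega> - simple_integral W k \<tau> \<xi> q \<omega>)
        - (simple_integral W k' \<tau>' \<xi>' r \<omega> - simple_integral W k' \<tau>' \<xi>' q \<omega>)"
      using G.simple_integral_increment[of W \<xi> \<omega>] G'.simple_integral_increment[of W \<xi>' \<omega>] t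
      by (simp add: D_def left_diff_distrib sum_subtractf)
    moreover have "\<bar>simple_integral W k \<tau> \<xi> s \<omega> - I s \<omega>\<bar> \<le> \<epsilon>'"
      "\<bar>simple_integral W k' \<tau>' \<xi>' s \<omega> - I' s \<omega>\<bar> \<le> \<epsilon>'" if "s = q \<or> s = r" for s
      using cl cl' \<omega> qr that by auto
    note this[of q, OF disjI1[OF refl]] this[of r, OF disjI2[OF refl]]
    ultimately show ?thesis
      using \<epsilon>'(2) unfolding abs_le_iff by (intro conjI; linarith)
  qed
  show ?thesis
  proof (intro bexI[of _ "E1 \<union> E2 \<union> E3"] conjI ballI impI)
    have "measure M (E1 \<union> E2 \<union> E3) \<le> measure M E1 + measure M E2 + measure M E3"
      using E1(1) E2(1) E3(1)
      by (intro order_trans[OF measure_Un_le] add_right_mono measure_Un_le sets.Un)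
    also have "\<dots> \<le> \<eta> / 3 + \<eta> / 3 + \<eta> / 3"
      using E1(2) E2(2) E3(2) \<epsilon>'(3) by (intro add_mono) (auto intro: order_trans)
    finally show "measure M (E1 \<union> E2 \<union> E3) \<le> \<eta>"
      by simp
    show "E1 \<union> E2 \<union> E3 \<in> sets M"
      using E1(1) E2(1) E3(1) by simp
  qed (rule close, auto)
qed

theorem ito_integral_local:
  assumes W: "brownian_motion M F W"
    and I: "is_ito_integral M F W H I" and I': "is_ito_integral M F W H' I'"
    and qr: "0 \<le> q" "q < r"
  shows "AE \<omega> in M. (\<forall>s\<in>{q..r}. H s \<omega> = H' s \<omega>) \<longrightarrow> I r \<omega> - I q \<omega> = I' r \<omega> - I' q \<omega>"
proof -
  have "AE \<omega> in M. (\<forall>s\<in>{q..r}. H s \<omega> = H' s \<omega>) \<longrightarrow> (I r \<omega> - I q \<omega>) - (I' r \<omega> - I' q \<omega>) = 0"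
    by (rule AE_eq_0_if_small_exceptional_sets[OF ito_integral_local_tail[OF W I I' qr]])
  then show ?thesis by simp
qed

end

section \<open>Local times\<close>

text \<open>Local times only provide integrability of \<open>sgn (X - c) \<cdot> b\<close>, which says nothing about \<open>b\<close> where
  \<open>X = c\<close>; a second level \<open>d\<close> fills this gap.\<close>

lemma set_integrable_if_sgn_mult:
  fixes X b :: "real \<Rightarrow> real"
  assumes X: "continuous_on {0..t} X" and "0 \<le> t" and "c \<noteq> d"
    and f: "set_integrable lborel {0..t} (\<lambda>s. sgn (X s - c) * b s)"
    and g: "set_integrable lborel {0..t} (\<lambda>s. sgn (X s - d) * b s)"
  shows "set_integrable lborel {0..t} b"
proof -
  let ?u = "\<lambda>s. indicator {0..t} s *\<^sub>R (sgn (X s - c) * b s)"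
  let ?v = "\<lambda>s. indicator {0..t} s *\<^sub>R (sgn (X s - d) * b s)"
  \<comment> \<open>Clamping the time makes the path continuous on the whole line, hence
    \<open>k\<close> Borel.\<close>
  define k where "k s = sgn (X (max 0 (min t s)) - c)" for s
  have u: "integrable lborel ?u" and v: "integrable lborel ?v"
    using f g by (simp_all add: set_integrable_def)
  have "continuous_on UNIV (\<lambda>s. X (max 0 (min t s)))"
    using \<open>0 \<le> t\<close> by (intro continuous_on_compose2[OF X] continuous_intros) auto
  then have "(\<lambda>s. X (max 0 (min t s))) \<in> borel_measurable lborel"
    using borel_measurable_continuous_onI by simp
  then have [measurable]: "k \<in> borel_measurable lborel"
    unfolding k_def[abs_def] by measurable
  note [measurable] = borel_measurable_integrable[OF u] borel_measurable_integrable[OF v]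
  \<comment> \<open>Off the level \<open>c\<close>, \<open>k\<close> squares to 1 and the first term
    restores \<open>b\<close>. On the level \<open>k\<close> is 0 and \<open>sgn (X s - d)\<close>
    equals \<open>sgn (c - d)\<close>, which also squares to 1.\<close>
  have eq: "indicator {0..t} s *\<^sub>R b s = k s * ?u s + (1 - (k s)\<^sup>2) * sgn (c - d) * ?v s" for s
  proof (cases "s \<in> {0..t}")
    case True
    have "sgn (c - d) * sgn (c - d) = 1"
      using \<open>c \<noteq> d\<close> by (auto simp: sgn_if)
    then show ?thesis
      using True by (cases "X s" c rule: linorder_cases) (auto simp: k_def power2_eq_square mult.assoc[symmetric])
  qed simp
  have "integrable lborel (\<lambda>s. indicator {0..t} s *\<^sub>R b s)"
  proof (rule Bochner_Integration.integrable_bound)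
    show "integrable lborel (\<lambda>s. \<bar>?u s\<bar> + \<bar>?v s\<bar>)"
      using u v by (intro Bochner_Integration.integrable_add integrable_abs)
    show "(\<lambda>s. indicator {0..t} s *\<^sub>R b s) \<in> borel_measurable lborel"
      unfolding eq by measurable
    show "AE s in lborel. norm (indicator {0..t} s *\<^sub>R b s) \<le> norm (\<bar>?u s\<bar> + \<bar>?v s\<bar>)"
      using \<open>c \<noteq> d\<close> by (intro AE_I2) (auto simp: indicator_def abs_mult sgn_if)
  qed
  then show ?thesis
    by (simp add: set_integrable_def)
qed

lemma set_lebesgue_integral_split:
  fixes f :: "real \<Rightarrow> real"
  assumes "set_integrable lborel {0..r} f" "0 \<le> q" "q \<le> r"
  shows "(LINT s:{0..r}|lborel. f s) = (LINT s:{0..q}|lborel. f s) + (LINT s:{q<..r}|lborel. f s)"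
proof -
  have "{0..r} = {0..q} \<union> {q<..r}"
    using assms by auto
  moreover have "(LINT s:{0..q} \<union> {q<..r}|lborel. f s)
      = (LINT s:{0..q}|lborel. f s) + (LINT s:{q<..r}|lborel. f s)"
    using assms by (intro set_integral_Un) (auto intro: set_integrable_subset)
  ultimately show ?thesis by simp
qed

lemma local_time_flat:
  assumes X: "weak_solution p m x M F W X" and L: "local_time p m x M F W X L"
    and qr: "0 \<le> q" "q < r"
  shows "AE \<omega> in M. (\<forall>s\<in>{q..r}. X s \<omega> \<noteq> c) \<longrightarrow> L r c \<omega> = L q c \<omega>"
proof -
  interpret stochastic_basis M F
    using X by (simp add: weak_solution_def)
  let ?\<sigma> = "diffusion_coeff p m x X" and ?b = "drift_coeff p m x X"
  have W: "brownian_motion M F W" and X_cont: "continuous_process M X"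
    using X by (simp_all add: weak_solution_def)
  obtain I where I: "is_ito_integral M F W ?\<sigma> I"
    and sde: "AE \<omega> in M. \<forall>t\<ge>0. X t \<omega> = X 0 \<omega> + I t \<omega> + (LINT s:{0..t}|lborel. ?b s \<omega>)"
    using X unfolding weak_solution_def by blast
  \<comment> \<open>Stated for every level, since a second one is used below to integrate the drift
    itself.\<close>
  have tanaka: "\<exists>J. is_ito_integral M F W (\<lambda>s \<omega>. sgn (X s \<omega> - c) * ?\<sigma> s \<omega>) J \<and>
      (AE \<omega> in M. \<forall>t\<ge>0. set_integrable lborel {0..t} (\<lambda>s. sgn (X s \<omega> - c) * ?b s \<omega>) \<and>
        \<bar>X t \<omega> - c\<bar> = \<bar>x - c\<bar> + (J t \<omega> + (LINT s:{0..t}|lborel. sgn (X s \<omega> - c) * ?b s \<omega>)) + L t c \<omega>)"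
    for c
  proof -
    obtain Y where Y: "is_ito_process_integral M F W ?\<sigma> ?b (\<lambda>s \<omega>. sgn (X s \<omega> - c)) Y"
      and Y': "AE \<omega> in M. \<forall>t\<ge>0. \<bar>X t \<omega> - c\<bar> = \<bar>x - c\<bar> + Y t \<omega> + L t c \<omega>"
      using L unfolding local_time_def by blast
    obtain J where J: "is_ito_integral M F W (\<lambda>s \<omega>. sgn (X s \<omega> - c) * ?\<sigma> s \<omega>) J"
      and J': "AE \<omega> in M. \<forall>t\<ge>0. set_integrable lborel {0..t} (\<lambda>s. sgn (X s \<omega> - c) * ?b s \<omega>) \<and>
        Y t \<omega> = J t \<omega> + (LINT s:{0..t}|lborel. sgn (X s \<omega> - c) * ?b s \<omega>)"
      using Y unfolding is_ito_process_integral_def by blast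
    from Y' J' have "AE \<omega> in M. \<forall>t\<ge>0. set_integrable lborel {0..t} (\<lambda>s. sgn (X s \<omega> - c) * ?b s \<omega>) \<and>
        \<bar>X t \<omega> - c\<bar> = \<bar>x - c\<bar> + (J t \<omega> + (LINT s:{0..t}|lborel. sgn (X s \<omega> - c) * ?b s \<omega>)) + L t c \<omega>"
      by eventually_elim simp
    with J show ?thesis by blast
  qed
  obtain J where J: "is_ito_integral M F W (\<lambda>s \<omega>. sgn (X s \<omega> - c) * ?\<sigma> s \<omega>) J"
    and Lc: "AE \<omega> in M. \<forall>t\<ge>0. set_integrable lborel {0..t} (\<lambda>s. sgn (X s \<omega> - c) * ?b s \<omega>) \<and>
      \<bar>X t \<omega> - c\<bar> = \<bar>x - c\<bar> + (J t \<omega> + (LINT s:{0..t}|lborel. sgn (X s \<omega> - c) * ?b s \<omega>)) + L t c \<omega>"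
    using tanaka by blast
  \<comment> \<open>The level \<open>c - 1\<close> is an arbitrary second one. Splitting the drift
    integral at \<open>q\<close> requires integrability, while the moment condition in
    \<open>weak_solution\<close> bounds a nonnegative integral without giving measurability of the
    drift along a path.\<close>
  have Lc': "AE \<omega> in M. \<forall>t\<ge>0. set_integrable lborel {0..t} (\<lambda>s. sgn (X s \<omega> - (c - 1)) * ?b s \<omega>)"
    using tanaka[of "c - 1"] by (auto elim: AE_mp)
  \<comment> \<open>Which sign occurs depends on the path, so the null sets of both cases are
    discarded beforehand.\<close>
  have above: "AE \<omega> in M. (\<forall>s\<in>{q..r}. sgn (X s \<omega> - c) * ?\<sigma> s \<omega> = ?\<sigma> s \<omega>) \<longrightarrow>
      J r \<omega> - J q \<omega> = I r \<omega> - I q \<omega>"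
    by (rule ito_integral_local[OF W J I qr])
  have below: "AE \<omega> in M. (\<forall>s\<in>{q..r}. sgn (X s \<omega> - c) * ?\<sigma> s \<omega> = - ?\<sigma> s \<omega>) \<longrightarrow>
      J r \<omega> - J q \<omega> = - I r \<omega> - - I q \<omega>"
    by (rule ito_integral_local[OF W J is_ito_integral_uminus[OF I] qr])
  from AE_space sde Lc Lc' above below show ?thesis
  proof (eventually_elim, intro impI)
    fix \<omega>
    assume \<omega>: "\<omega> \<in> space M"
      and sde: "\<forall>t\<ge>0. X t \<omega> = X 0 \<omega> + I t \<omega> + (LINT s:{0..t}|lborel. ?b s \<omega>)"
      and Lc: "\<forall>t\<ge>0. set_integrable lborel {0..t} (\<lambda>s. sgn (X s \<omega> - c) * ?b s \<omega>) \<and>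
        \<bar>X t \<omega> - c\<bar> = \<bar>x - c\<bar> + (J t \<omega> + (LINT s:{0..t}|lborel. sgn (X s \<omega> - c) * ?b s \<omega>)) + L t c \<omega>"
      and Lc': "\<forall>t\<ge>0. set_integrable lborel {0..t} (\<lambda>s. sgn (X s \<omega> - (c - 1)) * ?b s \<omega>)"
      and above: "(\<forall>s\<in>{q..r}. sgn (X s \<omega> - c) * ?\<sigma> s \<omega> = ?\<sigma> s \<omega>) \<longrightarrow> J r \<omega> - J q \<omega> = I r \<omega> - I q \<omega>"
      and below: "(\<forall>s\<in>{q..r}. sgn (X s \<omega> - c) * ?\<sigma> s \<omega> = - ?\<sigma> s \<omega>) \<longrightarrow>
        J r \<omega> - J q \<omega> = - I r \<omega> - - I q \<omega>"
      and ne: "\<forall>s\<in>{q..r}. X s \<omega> \<noteq> c"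
    have r: "0 \<le> r"
      using qr by simp
    have Xc: "continuous_on {0..} (\<lambda>t. X t \<omega>)"
      using X_cont \<omega> by (simp add: continuous_process_def)
    have b: "set_integrable lborel {0..r} (\<lambda>s. ?b s \<omega>)"
    proof (rule set_integrable_if_sgn_mult)
      show "continuous_on {0..r} (\<lambda>t. X t \<omega>)"
        by (rule continuous_on_subset[OF Xc]) auto
      show "set_integrable lborel {0..r} (\<lambda>s. sgn (X s \<omega> - c) * ?b s \<omega>)"
        "set_integrable lborel {0..r} (\<lambda>s. sgn (X s \<omega> - (c - 1)) * ?b s \<omega>)"
        using Lc Lc' r by blast+
    qed (use r in simp_all)
    let ?A = "LINT s:{q<..r}|lborel. ?b s \<omega>"
    let ?B = "LINT s:{q<..r}|lborel. sgn (X s \<omega> - c) * ?b s \<omega>"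
    have dX: "X r \<omega> - X q \<omega> = I r \<omega> - I q \<omega> + ?A"
      using sde[rule_format, of r] sde[rule_format, of q] set_lebesgue_integral_split[OF b, of q] qr
      by simp
    have dL: "L r c \<omega> - L q c \<omega> = (\<bar>X r \<omega> - c\<bar> - \<bar>X q \<omega> - c\<bar>) - (J r \<omega> - J q \<omega>) - ?B"
      using Lc[rule_format, of r] Lc[rule_format, of q]
        set_lebesgue_integral_split[of r "\<lambda>s. sgn (X s \<omega> - c) * ?b s \<omega>" q] qr
      by simp
    have conn: "connected ((\<lambda>s. X s \<omega>) ` {q..r})"
      using qr by (intro connected_continuous_image continuous_on_subset[OF Xc]) auto
    have "(\<forall>s\<in>{q..r}. c < X s \<omega>) \<or> (\<forall>s\<in>{q..r}. X s \<omega> < c)"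
    proof (rule ccontr)
      assume "\<not> ?thesis"
      then obtain s s' where "s \<in> {q..r}" "X s \<omega> \<le> c" "s' \<in> {q..r}" "c \<le> X s' \<omega>"
        by (auto simp: not_less)
      then have "c \<in> (\<lambda>s. X s \<omega>) ` {q..r}"
        using connectedD_interval[OF conn, of "X s \<omega>" "X s' \<omega>" c] by blast
      then show False
        using ne by auto
    qed
    then show "L r c \<omega> = L q c \<omega>"
    proof
      assume up: "\<forall>s\<in>{q..r}. c < X s \<omega>"
      have "?B = ?A"
        using up by (intro set_lebesgue_integral_cong) auto
      moreover have "J r \<omega> - J q \<omega> = I r \<omega> - I q \<omega>"
        using above up by simp
      ultimately show ?thesis
        using dX dL up[rule_format, of q] up[rule_format, of r] qr by simp
    next
      assume down: "\<forall>s\<in>{q..r}. X s \<omega> < c"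
      have "?B = (LINT s:{q<..r}|lborel. - ?b s \<omega>)"
        using down by (intro set_lebesgue_integral_cong) auto
      also have "\<dots> = - ?A"
        by (simp add: set_lebesgue_integral_def)
      finally have "?B = - ?A" .
      moreover have "J r \<omega> - J q \<omega> = - I r \<omega> - - I q \<omega>"
        using below down by simp
      ultimately show ?thesis
        using dX dL down[rule_format, of q] down[rule_format, of r] qr by simp
    qed
  qed
qed

section \<open>Initial values of the solution and of its local time\<close>

text \<open>\<open>bar_C\<close> is a definite description whose sign is not established here. With
  \<open>max (bar_C p m) 0\<close> the support radius is right for every value: a nonpositive
  constant gives radius 0 and a vanishing profile.\<close>

lemma bar_w_eq_0:
  assumes p: "1 < p" and m: "0 < m" "1 < m * (p - 1)" and t: "0 < t"
    and far: "(max (bar_C p m) 0 / bar_kappa p m) powr ((p - 1) / p) * t powr (1 / bar_beta p m) \<le> \<bar>y - x\<bar>"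
  shows "bar_w p m x t y = 0"
proof -
  let ?\<beta> = "bar_beta p m" and ?\<kappa> = "bar_kappa p m" and ?C = "bar_C p m"
  let ?R = "(max ?C 0 / ?\<kappa>) powr ((p - 1) / p)"
  have \<beta>: "0 < ?\<beta>"
    using p m by (simp add: bar_beta_def)
  have \<kappa>: "0 < ?\<kappa>"
    using p m \<beta> by (simp add: bar_kappa_def)
  have "?R = t powr (- (1 / ?\<beta>)) * (?R * t powr (1 / ?\<beta>))"
    using t by (simp add: powr_minus field_simps)
  also have "\<dots> \<le> t powr (- (1 / ?\<beta>)) * \<bar>y - x\<bar>"
    using far by (intro mult_left_mono) auto
  finally have "?R powr (p / (p - 1)) \<le> (t powr (- (1 / ?\<beta>)) * \<bar>y - x\<bar>) powr (p / (p - 1))"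
    using p by (intro powr_mono2) auto
  moreover have "?R powr (p / (p - 1)) = max ?C 0 / ?\<kappa>"
    using p \<kappa> by (simp add: powr_powr)
  ultimately have "max ?C 0 \<le> ?\<kappa> * (t powr (- (1 / ?\<beta>)) * \<bar>y - x\<bar>) powr (p / (p - 1))"
    using \<kappa> by (simp add: field_simps)
  then have "max (?C - ?\<kappa> * (t powr (- (1 / ?\<beta>)) * \<bar>y - x\<bar>) powr (p / (p - 1))) 0 = 0"
    by simp
  then show ?thesis
    unfolding bar_w_def bar_U_def bar_profile_def by simp
qed

text \<open>The law at time \<open>t\<close> lives within distance
  \<open>R * t powr (1 / \<beta>)\<close> of \<open>x\<close>. This bound tends to 0 along the times
  \<open>1 / (n + 1)\<close>, and path continuity carries it to time 0.\<close>

lemma weak_solution_start: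
  assumes p: "1 < p" and m: "0 < m" "1 < m * (p - 1)" and X: "weak_solution p m x M F W X"
  shows "AE \<omega> in M. X 0 \<omega> = x"
proof -
  interpret stochastic_basis M F
    using X by (simp add: weak_solution_def)
  define R where "R = (max (bar_C p m) 0 / bar_kappa p m) powr ((p - 1) / p)"
  have \<beta>: "0 < bar_beta p m"
    using p m by (simp add: bar_beta_def)
  have "AE \<omega> in M. \<bar>X t \<omega> - x\<bar> \<le> R * t powr (1 / bar_beta p m)" if t: "0 < t" for t
  proof -
    let ?A = "{y. \<not> \<bar>y - x\<bar> \<le> R * t powr (1 / bar_beta p m)}"
    have D: "distributed M lborel (X t) (\<lambda>y. ennreal (bar_w p m x t y))"
      using X t by (simp add: weak_solution_def)
    then have [measurable]: "X t \<in> borel_measurable M"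
      using distributed_measurable by fastforce
    have [measurable]: "?A \<in> sets borel"
      by measurable
    have "bar_w p m x t y = 0" if "y \<in> ?A" for y
      using that by (intro bar_w_eq_0[OF p m t]) (simp add: R_def)
    then have "ennreal (bar_w p m x t y) * indicator ?A y = 0" for y
      by (cases "y \<in> ?A") simp_all
    then have "emeasure M (X t -` ?A \<inter> space M) = 0"
      using distributed_emeasure[OF D, of ?A] by (simp only: nn_integral_const mult_zero_left) simp
    then have "X t -` ?A \<inter> space M \<in> null_sets M"
      by (auto simp: null_sets_def)
    then show ?thesis
      by (rule AE_I') auto
  qed
  then have "AE \<omega> in M. \<forall>n. \<bar>X (inverse (real (Suc n))) \<omega> - x\<bar>
      \<le> R * inverse (real (Suc n)) powr (1 / bar_beta p m)"
    by (intro AE_all_countable[THEN iffD2] allI) simp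
  with AE_space show ?thesis
  proof eventually_elim
    case (elim \<omega>)
    have "((\<lambda>t. X t \<omega>) \<longlongrightarrow> X 0 \<omega>) (at 0 within {0..})"
      using X elim(1) by (auto simp: weak_solution_def continuous_process_def continuous_on_def)
    moreover have "filterlim (\<lambda>n. inverse (real (Suc n))) (at 0 within {0..}) sequentially"
      unfolding filterlim_at using LIMSEQ_inverse_real_of_nat
      by (intro conjI always_eventually allI) simp_all
    ultimately have "(\<lambda>n. X (inverse (real (Suc n))) \<omega>) \<longlonglongrightarrow> X 0 \<omega>"
      by (rule filterlim_compose)
    then have 1: "(\<lambda>n. \<bar>X (inverse (real (Suc n))) \<omega> - x\<bar>) \<longlonglongrightarrow> \<bar>X 0 \<omega> - x\<bar>"
      by (intro tendsto_intros)
    have "(\<lambda>n. inverse (real (Suc n)) powr (1 / bar_beta p m)) \<longlonglongrightarrow> 0"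
      using LIMSEQ_inverse_real_of_nat \<beta> by (intro tendsto_zero_powrI[OF _ tendsto_const]) auto
    then have 2: "(\<lambda>n. R * inverse (real (Suc n)) powr (1 / bar_beta p m)) \<longlonglongrightarrow> 0"
      by (rule tendsto_mult_right_zero)
    have "\<bar>X 0 \<omega> - x\<bar> \<le> 0"
      using elim(2) by (intro LIMSEQ_le[OF 1 2]) auto
    then show ?case by simp
  qed
qed

text \<open>Tanaka's formula starts from \<open>\<bar>x - c\<bar>\<close>, not from
  \<open>\<bar>X 0 - c\<bar>\<close>, so the almost sure start at \<open>x\<close> is what makes the
  local time vanish initially.\<close>

lemma local_time_0:
  assumes p: "1 < p" and m: "0 < m" "1 < m * (p - 1)" and X: "weak_solution p m x M F W X"
    and L: "local_time p m x M F W X L"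
  shows "AE \<omega> in M. L 0 c \<omega> = 0"
proof -
  interpret stochastic_basis M F
    using X by (simp add: weak_solution_def)
  have W: "brownian_motion M F W"
    using X by (simp add: weak_solution_def)
  obtain Y where Y: "is_ito_process_integral M F W (diffusion_coeff p m x X) (drift_coeff p m x X)
        (\<lambda>s \<omega>. sgn (X s \<omega> - c)) Y"
    and Y': "AE \<omega> in M. \<forall>t\<ge>0. \<bar>X t \<omega> - c\<bar> = \<bar>x - c\<bar> + Y t \<omega> + L t c \<omega>"
    using L unfolding local_time_def by blast
  obtain J where J: "is_ito_integral M F W (\<lambda>s \<omega>. sgn (X s \<omega> - c) * diffusion_coeff p m x X s \<omega>) J"
    and J': "AE \<omega> in M. \<forall>t\<ge>0. set_integrable lborel {0..t} (\<lambda>s. sgn (X s \<omega> - c) * drift_coeff p m x X s \<omega>) \<and>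
      Y t \<omega> = J t \<omega> + (LINT s:{0..t}|lborel. sgn (X s \<omega> - c) * drift_coeff p m x X s \<omega>)"
    using Y unfolding is_ito_process_integral_def by blast
  have point: "(LINT s:{0..0}|lborel. f s) = 0" for f :: "real \<Rightarrow> real"
    unfolding set_lebesgue_integral_def
    by (rule integral_eq_zero_AE) (use AE_lborel_singleton[of 0] in \<open>auto elim: AE_mp\<close>)
  from Y' J' ito_integral_0[OF W J] weak_solution_start[OF p m X] show ?thesis
  proof eventually_elim
    case (elim \<omega>)
    then have "Y 0 \<omega> = 0"
      using point by simp
    moreover have "\<bar>X 0 \<omega> - c\<bar> = \<bar>x - c\<bar> + Y 0 \<omega> + L 0 c \<omega>"
      using elim by blast
    ultimately show ?case
      using elim by simp
  qed
qed

section \<open>From flat increments to concentration of the measure, path by path\<close>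

text \<open>Half-open intervals fit the distribution function: the mass of \<open>(q, r]\<close> is
  \<open>l r - l q\<close>. The point 0 belongs to the complement because
  \<open>f 0 \<noteq> c\<close>, and \<open>l 0 = 0\<close> makes it null.\<close>

lemma concentrated_on_level_set:
  fixes f l :: "real \<Rightarrow> real"
  assumes \<nu>: "sets \<nu> = sets (restrict_space borel {0..})"
    and l: "\<And>t. 0 \<le> t \<Longrightarrow> emeasure \<nu> {0..t} = ennreal (l t)" "l 0 = 0"
    and f: "continuous_on {0..} f" "f 0 \<noteq> c"
    and flat: "\<And>q r. q \<in> \<rat> \<Longrightarrow> r \<in> \<rat> \<Longrightarrow> 0 \<le> q \<Longrightarrow> q < r \<Longrightarrow> \<forall>s\<in>{q..r}. f s \<noteq> c \<Longrightarrow> l r = l q"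
  shows "concentrated_on \<nu> {t. 0 \<le> t \<and> f t = c}"
proof -
  have space: "space \<nu> = {0..}"
    using sets_eq_imp_space_eq[OF \<nu>] by (simp add: space_restrict_space)
  have sets: "A \<in> sets \<nu>" if "A \<in> sets borel" "A \<subseteq> {0..}" for A
    using that by (simp add: \<nu> sets_restrict_space_iff)
  define J where "J = {(q, r). q \<in> \<rat> \<and> r \<in> \<rat> \<and> 0 \<le> q \<and> q < r \<and> (\<forall>s\<in>{q..r}. f s \<noteq> c)}"
  have "countable (\<rat> \<times> \<rat> :: (real \<times> real) set)"
    by (intro countable_SIGMA countable_rat)
  then have J: "countable J"
    by (rule countable_subset[rotated]) (auto simp: J_def)
  have "{q<..r} \<in> null_sets \<nu>" if "(q, r) \<in> J" for q r
  proof -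
    have qr: "0 \<le> q" "q < r" "l r = l q"
      using that flat by (auto simp: J_def)
    \<comment> \<open>The subtraction is legitimate because the mass of \<open>[0, q]\<close> is a
      real number, hence finite.\<close>
    have "emeasure \<nu> ({0..r} - {0..q}) = emeasure \<nu> {0..r} - emeasure \<nu> {0..q}"
      using qr l(1)[of q] by (intro emeasure_Diff sets) auto
    also have "\<dots> = 0"
      using qr l(1)[of q] l(1)[of r] by simp
    also have "{0..r} - {0..q} = {q<..r}"
      using qr by auto
    finally show ?thesis
      using qr by (auto simp: null_sets_def intro!: sets)
  qed
  then have "(\<Union>(q, r)\<in>J. {q<..r}) \<in> null_sets \<nu>"
    using J by (intro null_sets_UN') auto
  moreover have "{0..0} \<in> null_sets \<nu>"
    using l(1)[of 0] l(2) by (auto simp: null_sets_def intro!: sets)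
  ultimately have null: "{0..0} \<union> (\<Union>(q, r)\<in>J. {q<..r}) \<in> null_sets \<nu>"
    by (rule null_sets.Un[rotated])
  have "space \<nu> - {t. 0 \<le> t \<and> f t = c} = {0..0} \<union> (\<Union>(q, r)\<in>J. {q<..r})"
  proof (intro antisym subsetI)
    fix t assume "t \<in> space \<nu> - {t. 0 \<le> t \<and> f t = c}"
    then have t: "0 \<le> t" "f t \<noteq> c"
      by (auto simp: space)
    show "t \<in> {0..0} \<union> (\<Union>(q, r)\<in>J. {q<..r})"
    proof (cases "t = 0")
      case False
      with t have "0 < t" by simp
      have "isCont f t"
        using f(1) \<open>0 < t\<close> by (simp add: continuous_on_interior)
      then have "\<forall>\<^sub>F s in nhds t. f s \<noteq> c"
        using t(2) unfolding isCont_def by (intro tendsto_imp_eventually_ne) (simp add: tendsto_at_iff_tendsto_nhds)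
      then obtain \<delta> where \<delta>: "0 < \<delta>" "\<And>s. dist s t < \<delta> \<Longrightarrow> f s \<noteq> c"
        by (auto simp: eventually_nhds_metric)
      obtain q where q: "q \<in> \<rat>" "max 0 (t - \<delta>) < q" "q < t"
        using Rats_dense_in_real[of "max 0 (t - \<delta>)" t] \<open>0 < t\<close> \<delta>(1) by auto
      obtain r where r: "r \<in> \<rat>" "t < r" "r < t + \<delta>"
        using Rats_dense_in_real[of t "t + \<delta>"] \<delta>(1) by auto
      have "f s \<noteq> c" if "s \<in> {q..r}" for s
        using q r that by (intro \<delta>(2)) (auto simp: dist_real_def)
      then have "(q, r) \<in> J"
        using q r by (auto simp: J_def)
      then show ?thesis
        using q r by (intro UnI2 UN_I[of "(q, r)"]) auto
    qed simp
  next
    fix t assume "t \<in> {0..0} \<union> (\<Union>(q, r)\<in>J. {q<..r})"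
    then show "t \<in> space \<nu> - {t. 0 \<le> t \<and> f t = c}"
      using f(2) by (force simp: space J_def)
  qed
  with null show ?thesis
    by (simp add: concentrated_on_def)
qed

theorem proposition3p12:
  fixes p m z x :: real
    and P :: "'w measure" and F :: "real \<Rightarrow> 'w measure"
    and W X :: "real \<Rightarrow> 'w \<Rightarrow> real"
    and L :: "real \<Rightarrow> real \<Rightarrow> 'w \<Rightarrow> real"
    and \<mu> :: "'w \<Rightarrow> real measure"
  assumes "1 < p" and "0 < m" and "m * (p - 1) > 1" and "p > 2"
    and "x \<noteq> z"
    and "weak_solution p m x P F W X"
    and "local_time p m x P F W X L"
    and "random_measure P \<mu>"
    and "AE \<omega> in P. \<forall>t\<ge>0. emeasure (\<mu> \<omega>) {0..t} = ennreal (L t z \<omega>)"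
  shows "AE \<omega> in P. concentrated_on (\<mu> \<omega>) {t. 0 \<le> t \<and> X t \<omega> = z}"
proof -
  let ?flat = "\<lambda>\<omega> q r. (\<forall>s\<in>{q..r}. X s \<omega> \<noteq> z) \<longrightarrow> L r z \<omega> = L q z \<omega>"
  \<comment> \<open>The interval on which the path avoids \<open>z\<close> depends on the path,
    while \<open>local_time_flat\<close> has a null set for each fixed pair of endpoints; rational
    endpoints keep the union of these null sets countable.\<close>
  have "AE \<omega> in P. \<forall>q\<in>\<rat> \<inter> {0..}. \<forall>r\<in>\<rat> \<inter> {q<..}. ?flat \<omega> q r"
    using local_time_flat[OF assms(6,7)]
    by (intro AE_ball_countable[THEN iffD2] ballI countable_Int1 countable_rat) auto
  with AE_space assms(9) local_time_0[OF assms(1-3,6,7), where c = z] weak_solution_start[OF assms(1-3,6)]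
  show ?thesis
  proof eventually_elim
    case (elim \<omega>)
    show ?case
    proof (rule concentrated_on_level_set[where l = "\<lambda>t. L t z \<omega>"])
      show "sets (\<mu> \<omega>) = sets (restrict_space borel {0..})"
        using assms(8) elim(1) by (simp add: random_measure_def)
      show "continuous_on {0..} (\<lambda>t. X t \<omega>)"
        using assms(6) elim(1) by (simp add: weak_solution_def continuous_process_def)
    \<comment> \<open>Here \<open>x \<noteq> z\<close> enters: with \<open>X 0 = x\<close> the path
      starts off the level.\<close>
    qed (use elim assms(5) in auto)
  qed
qed

end
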